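(* Let $M$ be the Macdonald map, sending each bounded pair $(\mathbf a,\mathbf b)$ to a $cD$-pair $(\mathbf c,D)$, and let $N$ be the map computed by the Inverse Macdonald Map algorithm, sending each $cD$-pair $(\mathbf c,D)$ to a bounded pair $(\mathbf a,\mathbf b)$ (both algorithms are defined in the context). Then $N$ is the inverse of $M$: that is, $N(M(\mathbf a,\mathbf b))=(\mathbf a,\mathbf b)$ for every bounded pair $(\mathbf a,\mathbf b)$, and $M(N(\mathbf c,D))=(\mathbf c,D)$ for every $cD$-pair $(\mathbf c,D)$.
   Context: **Permutations and words.** $S_\infty$ is the group of permutations of $\{1,2,\dots\}$ fixing all but finitely many elements, with $(\pi\tau)(i)=\pi(\tau(i))$. $t_{ij}$ is the transposition of $i,j$, $t_{rr}=\mathrm{id}$, and $s_i=t_{i,i+1}$. An inversion of $\pi$ is a pair $(i,j)$ with $i<j$, $\pi(i)>\pi(j)$; $\ell(\pi)$ is the number of inversions. For $\pi\ne\mathrm{id}$, the lex largest inversion $(r,s)$ of $\pi$ is the inversion with $r$ maximal and then, for this $r$, $s$ maximal; put $\nu=\pi t_{rs}$. A word is a finite tuple of integers. A word $\mathbf a=(a_1,\dots,a_p)$ of positive integers is a word for $\pi=s_{a_1}\cdots s_{a_p}$; it is reduced if $p=\ell(\pi)$; $R(\pi)$ is the set of reduced words for $\pi$. **Operations.** For a word $\mathbf a$: $\mathscr P^{\pm}_t\mathbf a$ replaces $a_t$ by $a_t\pm1$; $\mathscr D_t\mathbf a$ deletes the entry in position (column) $t$; $\mathscr I^x_t\mathbf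 a=(a_1,\dots,a_{t-1},x,a_t,\dots)$ inserts $x$ so that it becomes the entry in column $t$. The word $\mathbf a$ is nearly reduced at $t$ if $\mathscr D_t\mathbf a$ is reduced. If a word of positive integers is nearly reduced at $t$ but not reduced, there is exactly one other $t'\ne t$ at which it is nearly reduced; write $\mathrm{Defect}_t(\mathbf a)=t'$. **Crossings (right labels).** For a word $\mathbf a=(a_1,\dots,a_p)$ of positive integers, the wires crossing in column $t$ of its right-labeled wiring diagram are the two labels $\omega(a_t),\omega(a_t+1)$, where $\omega=s_{a_p}s_{a_{p-1}}\cdots s_{a_{t+1}}$. If $\mathbf a\in R(\pi)$, then for each inversion $(i,j)$ of $\pi$ there is exactly one column with crossing $\{i,j\}$. **Bounded pairs.** A bounded word for $\mathbf a$ is a word $\mathbf b$ of the same length with $1\le b_i\le a_i$ for all $i$. A bounded pair for $\pi$ is $(\mathbf a,\mathbf b)$ with $\mathbf a\in R(\pi)$ and $\mathbf b$ a bounded word for $\mathbf a$; $\mathrm{BoundedPairs}(\pi)$ is the set of them. **Bounded bumping algorithm** $\mathscr B^{\epsilon}_{t_0}(\mathbf a,\mathbf b)$, where $\epsilon\in\{+,-\}$ and $\mathbf a$ is nearly reduced at $t_0$ (in the uses below with $\epsilon=+$, the entry $b_{t_0}$ is allowed to be $0$ and $a_{t_0}$ may be $0$; all other entries satisfy $1\le b_i\le a_i$): (1) Set $\mathbf a'=\mathbf a$, $\mathbf b'=\mathbf b$, $t=t_0$. (2) Replace $\mathbf a'$ by $\mathscr P^\epsilon_t\mathbf a'$ and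 $\mathbf b'$ by $\mathscr P^\epsilon_t\mathbf b'$. (3) If $b'_t=0$, return $(\mathscr D_t\mathbf a',\mathscr D_t\mathbf b',a'_t,t,\mathsf{deleted})$ and stop. (4) If $\mathbf a'$ is reduced, return $(\mathbf a',\mathbf b',a'_t,t,\mathsf{bumped})$ and stop. (5) Set $t=\mathrm{Defect}_t(\mathbf a')$ and go to (2). **Pipe dreams.** A pipe dream $D$ is a finite subset of $\mathbb Z_{>0}\times\mathbb Z_{>0}$ (row, column). List its elements $(i_1,j_1),\dots,(i_p,j_p)$ in reading order: rows from top (row 1) to bottom, and from right to left (decreasing column) within each row. Put $\mathbf j_D=(j_1,\dots,j_p)$ and $\mathbf r_D=(i_1+j_1-1,\dots,i_p+j_p-1)$. The pair $(\mathbf r_D,\mathbf j_D)$ determines $D$ and is said to encode $D$. The permutation of $D$ is the product $s_{r_1}\cdots s_{r_p}$ for $\mathbf r_D=(r_1,\dots,r_p)$, and $D$ is reduced if $\mathbf r_D$ is reduced. $\mathcal{RP}(\pi)$ is the set of reduced pipe dreams with permutation $\pi$. **$cD$-pairs.** For $p=\ell(\pi)$ let $\mathcal C(\pi)=[1,1]\times[1,2]\times\cdots\times[1,p]$ (integer intervals). A $cD$-pair for $\pi$ is an element $(\mathbf c,D)\in\mathcal C(\pi)\times\mathcal{RP}(\pi)$. In the following, $\pi\ne\mathrm{id}$, $p=\ell(\pi)$, $(r,s)$ is the lex largest inversion of $\pi$, $\nu=\pi t_{rs}$; "admissible $q$" means $q=r$, or $1\le q<r$ with $\ell(\nu t_{qr})=\ell(\pi)$.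 **Transition map** $T_\pi$ on $\mathcal{RP}(\pi)$: for $D\in\mathcal{RP}(\pi)$ let $t_0$ be the column of the $\{r,s\}$-crossing of $\mathbf r_D$, compute $\mathscr B^-_{t_0}(\mathbf r_D,\mathbf j_D)=(\mathbf a',\mathbf b',i,j,\mathsf{outcome})$, and let $T_\pi(D)$ be the pipe dream encoded by $(\mathbf a',\mathbf b')$. It lies in $\mathcal{RP}(\nu t_{qr})$ for a unique admissible $q$, with $q=r$ iff $\mathsf{outcome}=\mathsf{deleted}$. **Inverse transition map** $T_\pi^{-1}$: given $E\in\mathcal{RP}(\nu t_{qr})$ with $q$ admissible: if $q=r$ set $j=p$, $\mathbf g=\mathscr I^{r-1}_p\mathbf r_E$, $\mathbf h=\mathscr I^0_p\mathbf j_E$; if $q<r$ set $\mathbf g=\mathbf r_E$, $\mathbf h=\mathbf j_E$ and let $j$ be the column of the $\{q,r\}$-crossing of $\mathbf r_E$. Compute $\mathscr B^+_j(\mathbf g,\mathbf h)=(\mathbf g',\mathbf h',i',t,\mathsf{bumped})$; $T_\pi^{-1}(E)$ is the pipe dream encoded by $(\mathbf g',\mathbf h')$. **Bounded transition** $BT_\pi$: given $(\mathbf a,\mathbf b)\in\mathrm{BoundedPairs}(\pi)$ let $t_0$ be the column of the $\{r,s\}$-crossing of $\mathbf a$ and compute $\mathscr B^-_{t_0}(\mathbf a,\mathbf b)=(\mathbf a',\mathbf b',i,j,\mathsf{outcome})$. If $\mathsf{outcome}=\mathsf{deleted}$, then $BT_\pi(\mathbf a,\mathbf b)=((\mathbf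 a',\mathbf b'),j)$, with $(\mathbf a',\mathbf b')\in\mathrm{BoundedPairs}(\nu)$, $j\in[1,p]$ (here $q=r$). If $\mathsf{outcome}=\mathsf{bumped}$, then $BT_\pi(\mathbf a,\mathbf b)=((\mathbf a',\mathbf b'),0)$, with $(\mathbf a',\mathbf b')\in\mathrm{BoundedPairs}(\nu t_{qr})$ for a unique admissible $q<r$. **Inverse bounded transition** $BT_\pi^{-1}$: given $((\mathbf e,\mathbf f),k)$ with either $(\mathbf e,\mathbf f)\in\mathrm{BoundedPairs}(\nu)$ and $k\in[1,p]$ (case $q=r$), or $(\mathbf e,\mathbf f)\in\mathrm{BoundedPairs}(\nu t_{qr})$ for an admissible $q<r$ and $k=0$. If $q=r$: let $\omega=s_{e_{p-1}}s_{e_{p-2}}\cdots s_{e_k}$ (with $\omega=\mathrm{id}$ if $k=p$), $i=\omega^{-1}(r)-1$, $\mathbf g=\mathscr I^i_k\mathbf e$, $\mathbf h=\mathscr I^0_k\mathbf f$, $j=k$. If $q<r$: $\mathbf g=\mathbf e$, $\mathbf h=\mathbf f$, and $j$ is the column of the $\{q,r\}$-crossing of $\mathbf e$. Compute $\mathscr B^+_j(\mathbf g,\mathbf h)=(\mathbf g',\mathbf h',i',t,\mathsf{bumped})$ and return $(\mathbf g',\mathbf h')$. **Macdonald map** $M$ (input: a bounded pair $(\mathbf a,\mathbf b)$ for $\pi$; output: a $cD$-pair for $\pi$): (1) If $\pi=\mathrm{id}$, return $((),\emptyset)$. (2) Compute $BT_\pi(\mathbf a,\mathbf b)=((\mathbf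 a',\mathbf b'),k)$, where $(\mathbf a',\mathbf b')$ is a bounded pair for $\nu t_{qr}$, $1\le q\le r$. (3) Recursively compute $M(\mathbf a',\mathbf b')=(\mathbf c',D')$. (4) Set $D=T_\pi^{-1}(D')$; if $q<r$ set $\mathbf c=\mathbf c'$, and if $q=r$ set $\mathbf c=\mathscr I^k_p\mathbf c'$ (append $k$). Return $(\mathbf c,D)$. **Inverse Macdonald Map algorithm** $N$ (input: a $cD$-pair $(\mathbf c,D)$ for $\pi$; output: a bounded pair for $\pi$): (1) If $\pi=\mathrm{id}$, return $((),())$. (2) Compute $D'=T_\pi(D)\in\mathcal{RP}(\nu t_{qr})$. If $q<r$ set $k=0$, $\mathbf c'=\mathbf c$; if $q=r$ set $k=c_p$, $\mathbf c'=(c_1,\dots,c_{p-1})$. (3) Recursively compute $N(\mathbf c',D')=(\mathbf a',\mathbf b')$. (4) Return $BT_\pi^{-1}((\mathbf a',\mathbf b'),k)$. The recursions terminate because $\nu t_{qr}$ is strictly smaller than $\pi$ in the following order: $\tau\prec\pi$ if the list of inversions of $\tau$ in decreasing lex order is lexicographically smaller than that of $\pi$. *)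

theory Defs
  imports "HOL-Combinatorics.Permutations" "HOL-Library.Monad_Syntax"
begin

text \<open>
  Permutations are functions on \<^typ>\<open>int\<close> fixing every nonpositive integer. Words are integer
  lists; entries may be 0 during the algorithms. Columns (positions) of words are natural numbers
  counted from 1, so the entry in column \<open>t\<close> of \<open>a\<close> is \<open>a ! (t - 1)\<close>.

  The algorithms return values of option type; the value \<^const>\<open>None\<close> stands for
  non-termination, or for an upward bump in an inverse transition whose outcome is not
  \<open>Bumped\<close>. An equation with \<^const>\<open>Some\<close> on the right thus includes the claim that the
  algorithm terminates.
\<close>

subsection \<open>Permutations and words\<close>

definition S_infinity :: "(int \<Rightarrow> int) set" where
  "S_infinity = {\<pi>. \<pi> permutes {1..} \<and> finite {i. \<pi> i \<noteq> i}}"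

definition inversions :: "(int \<Rightarrow> int) \<Rightarrow> (int \<times> int) set" where
  "inversions \<pi> = {(i, j). 1 \<le> i \<and> i < j \<and> \<pi> i > \<pi> j}"

definition perm_length :: "(int \<Rightarrow> int) \<Rightarrow> nat" where
  "perm_length \<pi> = card (inversions \<pi>)"

definition lex_r :: "(int \<Rightarrow> int) \<Rightarrow> int" where
  "lex_r \<pi> = Max {i. \<exists>j. (i, j) \<in> inversions \<pi>}"

definition lex_s :: "(int \<Rightarrow> int) \<Rightarrow> int" where
  "lex_s \<pi> = Max {j. (lex_r \<pi>, j) \<in> inversions \<pi>}"

definition nu :: "(int \<Rightarrow> int) \<Rightarrow> int \<Rightarrow> int" where
  "nu \<pi> = \<pi> \<circ> transpose (lex_r \<pi>) (lex_s \<pi>)"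

definition admissible :: "(int \<Rightarrow> int) \<Rightarrow> int \<Rightarrow> bool" where
  "admissible \<pi> q \<longleftrightarrow>
     q = lex_r \<pi> \<or>
     1 \<le> q \<and> q < lex_r \<pi> \<and> perm_length (nu \<pi> \<circ> transpose q (lex_r \<pi>)) = perm_length \<pi>"

text \<open>The admissible \<open>q\<close> with \<open>\<tau> = \<nu> t\<^sub>q\<^sub>r\<close>; it is determined by \<open>\<pi>\<close> and \<open>\<tau>\<close>.\<close>

definition transition_index :: "(int \<Rightarrow> int) \<Rightarrow> (int \<Rightarrow> int) \<Rightarrow> int" where
  "transition_index \<pi> \<tau> = (THE q. admissible \<pi> q \<and> \<tau> = nu \<pi> \<circ> transpose q (lex_r \<pi>))"

definition simple_transp :: "int \<Rightarrow> int \<Rightarrow> int" where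
  "simple_transp i = transpose i (i + 1)"

definition word_perm :: "int list \<Rightarrow> int \<Rightarrow> int" where
  "word_perm a = foldr (\<lambda>x f. simple_transp x \<circ> f) a id"

definition reduced :: "int list \<Rightarrow> bool" where
  "reduced a \<longleftrightarrow> (\<forall>x \<in> set a. 1 \<le> x) \<and> length a = perm_length (word_perm a)"

definition reduced_words :: "(int \<Rightarrow> int) \<Rightarrow> int list set" where
  "reduced_words \<pi> = {a. reduced a \<and> word_perm a = \<pi>}"

definition push :: "int \<Rightarrow> nat \<Rightarrow> int list \<Rightarrow> int list" where
  "push \<epsilon> t a = a[t - 1 := a ! (t - 1) + \<epsilon>]"

definition delete_col :: "nat \<Rightarrow> int list \<Rightarrow> int list" where
  "delete_col t a = take (t - 1) a @ drop t a"

definition insert_col :: "nat \<Rightarrow> 'a \<Rightarrow> 'a list \<Rightarrow> 'a list" where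
  "insert_col t x a = take (t - 1) a @ x # drop (t - 1) a"

definition nearly_reduced :: "int list \<Rightarrow> nat \<Rightarrow> bool" where
  "nearly_reduced a t \<longleftrightarrow> 1 \<le> t \<and> t \<le> length a \<and> reduced (delete_col t a)"

definition defect :: "nat \<Rightarrow> int list \<Rightarrow> nat" where
  "defect t a = (THE t'. t' \<noteq> t \<and> nearly_reduced a t')"

definition crossing :: "int list \<Rightarrow> nat \<Rightarrow> int set" where
  "crossing a t =
     (let \<omega> = word_perm (rev (drop t a)) in {\<omega> (a ! (t - 1)), \<omega> (a ! (t - 1) + 1)})"

definition crossing_col :: "int list \<Rightarrow> int \<Rightarrow> int \<Rightarrow> nat" where
  "crossing_col a i j = (THE t. 1 \<le> t \<and> t \<le> length a \<and> crossing a t = {i, j})"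

subsection \<open>Bounded pairs and bounded bumping\<close>

definition bounded_word :: "int list \<Rightarrow> int list \<Rightarrow> bool" where
  "bounded_word a b \<longleftrightarrow> length b = length a \<and> (\<forall>i < length a. 1 \<le> b ! i \<and> b ! i \<le> a ! i)"

definition bounded_pairs :: "(int \<Rightarrow> int) \<Rightarrow> (int list \<times> int list) set" where
  "bounded_pairs \<pi> = {(a, b). a \<in> reduced_words \<pi> \<and> bounded_word a b}"

datatype outcome = Deleted | Bumped

text \<open>The sign \<open>\<epsilon>\<close> is passed as the integer 1 or \<open>- 1\<close>.\<close>

partial_function (option) bounded_bump ::
  "int \<Rightarrow> nat \<Rightarrow> int list \<Rightarrow> int list \<Rightarrow> (int list \<times> int list \<times> int \<times> nat \<times> outcome) option"
where
  "bounded_bump \<epsilon> t a b =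
     (let a' = push \<epsilon> t a; b' = push \<epsilon> t b in
      if b' ! (t - 1) = 0 then Some (delete_col t a', delete_col t b', a' ! (t - 1), t, Deleted)
      else if reduced a' then Some (a', b', a' ! (t - 1), t, Bumped)
      else bounded_bump \<epsilon> (defect t a') a' b')"

subsection \<open>Pipe dreams and cD-pairs\<close>

definition pipe_dream :: "(int \<times> int) set \<Rightarrow> bool" where
  "pipe_dream D \<longleftrightarrow> finite D \<and> D \<subseteq> {1..} \<times> {1..}"

definition read_before :: "int \<times> int \<Rightarrow> int \<times> int \<Rightarrow> bool" where
  "read_before x y \<longleftrightarrow> fst x < fst y \<or> fst x = fst y \<and> snd x > snd y"

definition reading_list :: "(int \<times> int) set \<Rightarrow> (int \<times> int) list" where
  "reading_list D = (THE xs. set xs = D \<and> sorted_wrt read_before xs)"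

definition r_word :: "(int \<times> int) set \<Rightarrow> int list" where
  "r_word D = map (\<lambda>(i, j). i + j - 1) (reading_list D)"

definition j_word :: "(int \<times> int) set \<Rightarrow> int list" where
  "j_word D = map snd (reading_list D)"

definition encoded :: "int list \<Rightarrow> int list \<Rightarrow> (int \<times> int) set" where
  "encoded a b = (THE D. pipe_dream D \<and> r_word D = a \<and> j_word D = b)"

definition pipe_perm :: "(int \<times> int) set \<Rightarrow> int \<Rightarrow> int" where
  "pipe_perm D = word_perm (r_word D)"

definition reduced_pipe_dreams :: "(int \<Rightarrow> int) \<Rightarrow> (int \<times> int) set set" where
  "reduced_pipe_dreams \<pi> = {D. pipe_dream D \<and> reduced (r_word D) \<and> pipe_perm D = \<pi>}"

definition c_vectors :: "(int \<Rightarrow> int) \<Rightarrow> nat list set" where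
  "c_vectors \<pi> = {c. length c = perm_length \<pi> \<and> (\<forall>i < length c. 1 \<le> c ! i \<and> c ! i \<le> i + 1)}"

definition cD_pairs :: "(int \<Rightarrow> int) \<Rightarrow> (nat list \<times> (int \<times> int) set) set" where
  "cD_pairs \<pi> = c_vectors \<pi> \<times> reduced_pipe_dreams \<pi>"

subsection \<open>Transition maps\<close>

definition transition :: "(int \<Rightarrow> int) \<Rightarrow> (int \<times> int) set \<Rightarrow> (int \<times> int) set option" where
  "transition \<pi> D = do {
     (a', b', i, j, out) \<leftarrow>
       bounded_bump (- 1) (crossing_col (r_word D) (lex_r \<pi>) (lex_s \<pi>)) (r_word D) (j_word D);
     Some (encoded a' b')
   }"

definition inv_transition :: "(int \<Rightarrow> int) \<Rightarrow> (int \<times> int) set \<Rightarrow> (int \<times> int) set option" where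
  "inv_transition \<pi> E =
     (let r = lex_r \<pi>; p = perm_length \<pi>; q = transition_index \<pi> (pipe_perm E);
          (j, g, h) = (if q = r
                       then (p, insert_col p (r - 1) (r_word E), insert_col p 0 (j_word E))
                       else (crossing_col (r_word E) q r, r_word E, j_word E))
      in do {
        (g', h', i', t, out) \<leftarrow> bounded_bump 1 j g h;
        (case out of Bumped \<Rightarrow> Some (encoded g' h') | Deleted \<Rightarrow> None)
      })"

definition bounded_transition ::
  "(int \<Rightarrow> int) \<Rightarrow> int list \<Rightarrow> int list \<Rightarrow> ((int list \<times> int list) \<times> nat) option" where
  "bounded_transition \<pi> a b = do {
     (a', b', i, j, out) \<leftarrow> bounded_bump (- 1) (crossing_col a (lex_r \<pi>) (lex_s \<pi>)) a b;
     Some ((a', b'), case out of Deleted \<Rightarrow> j | Bumped \<Rightarrow> 0)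
   }"

definition inv_bounded_transition ::
  "(int \<Rightarrow> int) \<Rightarrow> int list \<Rightarrow> int list \<Rightarrow> nat \<Rightarrow> (int list \<times> int list) option" where
  "inv_bounded_transition \<pi> e f k =
     (let r = lex_r \<pi>; q = transition_index \<pi> (word_perm e);
          \<omega> = word_perm (rev (drop (k - 1) e));
          (j, g, h) = (if q = r
                       then (k, insert_col k (inv \<omega> r - 1) e, insert_col k 0 f)
                       else (crossing_col e q r, e, f))
      in do {
        (g', h', i', t, out) \<leftarrow> bounded_bump 1 j g h;
        (case out of Bumped \<Rightarrow> Some (g', h') | Deleted \<Rightarrow> None)
      })"

subsection \<open>The Macdonald map and its inverse algorithm\<close>

text \<open>The permutation \<open>\<pi>\<close> is recovered from the input, as the permutation of \<open>a\<close> or of \<open>D\<close>.\<close>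

partial_function (option) macdonald ::
  "int list \<times> int list \<Rightarrow> (nat list \<times> (int \<times> int) set) option"
where
  "macdonald ab =
     (let \<pi> = word_perm (fst ab) in
      if \<pi> = id then Some ([], {})
      else do {
        (ab', k) \<leftarrow> bounded_transition \<pi> (fst ab) (snd ab);
        (c', D') \<leftarrow> macdonald ab';
        D \<leftarrow> inv_transition \<pi> D';
        Some (if transition_index \<pi> (word_perm (fst ab')) < lex_r \<pi> then c'
              else insert_col (perm_length \<pi>) k c', D)
      })"

partial_function (option) inverse_macdonald ::
  "nat list \<times> (int \<times> int) set \<Rightarrow> (int list \<times> int list) option"
where
  "inverse_macdonald cD =
     (let c = fst cD; D = snd cD; \<pi> = pipe_perm D in
      if \<pi> = id then Some ([], [])
      else do {
        D' \<leftarrow> transition \<pi> D;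
        let (k, c') = (if transition_index \<pi> (pipe_perm D') < lex_r \<pi> then (0, c)
                       else (c ! (perm_length \<pi> - 1), take (perm_length \<pi> - 1) c));
        (a', b') \<leftarrow> inverse_macdonald (c', D');
        inv_bounded_transition \<pi> a' b' k
      })"

end

theory Submission
  imports Defs
begin

text \<open>
  The Macdonald map and its inverse are built by recursion from four maps: the bounded transition,
  the transition of pipe dreams, and their inverses. The theorem follows by induction once each
  transition is known to be a bijection, undone by its inverse, between the objects for \<open>\<pi>\<close> and the
  objects for the permutations \<open>\<nu> t\<^sub>q\<^sub>r\<close> with \<open>q\<close> admissible, where a deletion in the bounded
  transition comes with its column as an additional datum in \<open>[1, p]\<close>
  (\<open>bounded_transition_inverse\<close>, \<open>inv_bounded_transition_inverse\<close>, \<open>transition_inverse\<close>,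
  \<open>inv_transition_inverse\<close>). The recursion is well founded since each transition lowers the length
  or keeps it and lowers the lex largest inversion (\<open>successor_less\<close>).

  All four maps are bumping runs, and a bumping run can be traced backwards
  (\<open>bounded_bump_reversible\<close>). A push is undone by the opposite push. The move to the defect is an
  involution: if a word is nearly reduced at a column but not reduced, then the two wires that cross in
  this column also cross in exactly one other column, in the opposite direction, and these are the only
  columns at which the word is nearly reduced (\<open>defect_properties\<close>). It follows also that during a run
  the deletion of the current column always leaves a reduced word for the same \<open>\<nu>\<close>, and that the same
  wire \<open>r\<close> takes part in the current crossing, as the lower wire before a push down and as the upper
  wire before a push up (\<open>bump_state\<close>).

  This determines where a run can stop. A reduced word reached by a downward run is a word
  for \<open>\<nu> t\<^sub>q\<^sub>r\<close> in which \<open>r\<close> is the larger label, so \<open>q < r\<close>. A reduced word reached by an upward run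
  is a word for some \<open>\<nu> t\<^sub>r\<^sub>q\<close> with \<open>q > r\<close>, and as \<open>(r, s)\<close> is lex largest, \<open>q = s\<close> is the only
  possibility (\<open>cover_above_r\<close>), so the word belongs to \<open>\<pi>\<close> and its current column is the one at which
  the downward run starts. Downward runs terminate since they decrease the sum of \<open>b\<close>, and upward runs
  since the letters of reduced words for \<open>\<nu>\<close> are bounded (\<open>reduced_letter_moves\<close>).

  For pipe dreams it remains to see that a run preserves the reading order. Pushes preserve
  rows, and within a row they can only make two neighbouring letters equal, in which case the run
  continues by pushing the neighbour (\<open>rows_decrease\<close>). Moreover a deletion always happens in the
  last column with final letter \<open>r - 1\<close> (\<open>deletion_in_last_column\<close>), so the inverse transition need
  not be told where to insert.
\<close>

section \<open>Words, wires and crossings\<close>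

lemma word_perm_Nil [simp]: "word_perm [] = id"
  by (simp add: word_perm_def)

lemma word_perm_Cons [simp]: "word_perm (x # v) = simple_transp x \<circ> word_perm v"
  by (simp add: word_perm_def)

lemma word_perm_append: "word_perm (u @ v) = word_perm u \<circ> word_perm v"
  by (induction u) (simp_all add: o_assoc)

lemma simple_transp_involutive [simp]: "simple_transp x (simple_transp x i) = i"
  by (simp add: simple_transp_def)

lemma word_perm_rev_cancel [simp]: "word_perm (rev v) (word_perm v i) = i"
  by (induction v arbitrary: i) (simp_all add: word_perm_append)

lemma word_perm_cancel_rev [simp]: "word_perm v (word_perm (rev v) i) = i"
  using word_perm_rev_cancel[of "rev v"] by simp

lemma bij_word_perm: "bij (word_perm v)"
  by (rule o_bij[of "word_perm (rev v)"]) (auto simp: fun_eq_iff)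

lemma inj_word_perm: "inj (word_perm v)"
  using bij_word_perm bij_is_inj by blast

lemma word_perm_eq_iff [simp]: "word_perm v i = word_perm v j \<longleftrightarrow> i = j"
  by (simp add: inj_eq[OF inj_word_perm])

lemma inv_word_perm: "inv (word_perm v) = word_perm (rev v)"
  by (rule inv_unique_comp) (auto simp: fun_eq_iff)

lemma inj_comp_transpose:
  assumes "inj f"
  shows "f \<circ> transpose i j = transpose (f i) (f j) \<circ> f"
  using injD[OF assms] by (auto simp: fun_eq_iff transpose_def)

text \<open>Inserting a letter \<open>x\<close> between \<open>u\<close> and \<open>v\<close> multiplies the permutation on the right by the
  conjugate of \<open>s\<^sub>x\<close> by the suffix \<open>v\<close>, which is the transposition of the two wires that meet
  there.\<close>

lemma word_perm_insert:
  "word_perm (u @ x # v) =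
     word_perm (u @ v) \<circ> transpose (word_perm (rev v) x) (word_perm (rev v) (x + 1))"
proof -
  have "simple_transp x \<circ> word_perm v =
        word_perm v \<circ> transpose (word_perm (rev v) x) (word_perm (rev v) (x + 1))"
    by (simp add: inj_comp_transpose[OF inj_word_perm] simple_transp_def)
  then show ?thesis
    by (simp add: word_perm_append comp_assoc)
qed

lemma simple_transp_permutes: "1 \<le> x \<Longrightarrow> simple_transp x permutes {1..}"
  unfolding simple_transp_def by (intro permutes_swap_id) auto

lemma word_perm_permutes: "\<forall>x\<in>set v. 1 \<le> x \<Longrightarrow> word_perm v permutes {1..}"
proof (induction v)
  case Nil
  then show ?case by (simp only: word_perm_Nil permutes_id)
next
  case (Cons x v)
  then show ?case
    using permutes_compose[of "word_perm v" "{1..}" "simple_transp x"] simple_transp_permutes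
    by (simp del: o_apply)
qed

text \<open>Crossings are unordered pairs of labels, so inversions are handled in that form as well.\<close>

definition crossed :: "(int \<Rightarrow> int) \<Rightarrow> int set set" where
  "crossed \<pi> = {{i, j} | i j. i < j \<and> \<pi> j < \<pi> i}"

lemma pair_in_crossed:
  "{i, j} \<in> crossed \<pi> \<longleftrightarrow> i < j \<and> \<pi> j < \<pi> i \<or> j < i \<and> \<pi> i < \<pi> j"
  unfolding crossed_def by (auto simp: doubleton_eq_iff)

lemma perm_length_eq_card_crossed:
  assumes "\<pi> permutes {1..}"
  shows "perm_length \<pi> = card (crossed \<pi>)"
proof -
  have "crossed \<pi> = (\<lambda>(i, j). {i, j}) ` inversions \<pi>"
  proof (intro equalityI subsetI)
    fix C assume "C \<in> crossed \<pi>"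
    then obtain i j where C: "C = {i, j}" "i < j" "\<pi> j < \<pi> i"
      unfolding crossed_def by auto
    have "1 \<le> i"
    proof (rule ccontr)
      assume "\<not> 1 \<le> i"
      then have "\<pi> i = i" using permutes_not_in[OF assms] by simp
      moreover have "\<pi> j < 1" using C \<open>\<not> 1 \<le> i\<close> calculation by linarith
      then have "\<pi> j = j" using permutes_in_image[OF assms, of j] permutes_not_in[OF assms, of j]
        by (metis atLeast_iff not_less)
      ultimately show False using C by linarith
    qed
    then show "C \<in> (\<lambda>(i, j). {i, j}) ` inversions \<pi>"
      using C by (force simp: inversions_def)
  qed (auto simp: inversions_def crossed_def)
  moreover have "inj_on (\<lambda>(i, j). {i, j}) (inversions \<pi>)"
    by (auto simp: inj_on_def inversions_def doubleton_eq_iff)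
  ultimately show ?thesis
    by (simp add: perm_length_def card_image)
qed

lemma crossed_word_perm_Cons:
  defines "C \<equiv> \<lambda>x v. {word_perm (rev v) x, word_perm (rev v) (x + 1)}"
  shows "crossed (word_perm (x # v)) =
    (if C x v \<in> crossed (word_perm v) then crossed (word_perm v) - {C x v}
     else insert (C x v) (crossed (word_perm v)))"
proof -
  let ?f = "word_perm v" and ?g = "word_perm (rev v)"
  have flip: "C x v \<in> crossed (word_perm (x # v)) \<longleftrightarrow> C x v \<notin> crossed ?f"
    unfolding C_def pair_in_crossed by (auto simp: simple_transp_def)
      (metis add_cancel_right_right linorder_neqE_linordered_idom word_perm_eq_iff zero_neq_one)
  have other: "{i, j} \<in> crossed (word_perm (x # v)) \<longleftrightarrow> {i, j} \<in> crossed ?f"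
    if "i < j" "{i, j} \<noteq> C x v" for i j
  proof -
    have "{?f i, ?f j} \<noteq> {x, x + 1}"
      using that(2) unfolding C_def
      by (metis doubleton_eq_iff word_perm_rev_cancel)
    moreover have "?f i < ?f j \<or> ?f j < ?f i" using that(1) by (simp add: neq_iff[symmetric])
    ultimately have "simple_transp x (?f j) < simple_transp x (?f i) \<longleftrightarrow> ?f j < ?f i"
      unfolding simple_transp_def transpose_def by (auto simp: doubleton_eq_iff)
    then show ?thesis using that(1) by (auto simp: pair_in_crossed)
  qed
  have pairs: "\<exists>i j. P = {i, j} \<and> i < j" if "P \<in> crossed h" for P h
    using that unfolding crossed_def by auto
  have "P \<in> crossed (word_perm (x # v)) \<longleftrightarrow>
        P \<in> (if C x v \<in> crossed ?f then crossed ?f - {C x v} else insert (C x v) (crossed ?f))" for P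
  proof (cases "P = C x v")
    case True
    then show ?thesis using flip by (auto simp del: word_perm_Cons)
  next
    case False
    then have "P \<in> crossed (word_perm (x # v)) \<longleftrightarrow> P \<in> crossed ?f"
      using other pairs by metis
    then show ?thesis using False by auto
  qed
  then show ?thesis by blast
qed

fun crossings :: "int list \<Rightarrow> int set list" where
  "crossings [] = []"
| "crossings (x # v) = {word_perm (rev v) x, word_perm (rev v) (x + 1)} # crossings v"

lemma length_crossings [simp]: "length (crossings a) = length a"
  by (induction a) auto

lemma crossings_append:
  "crossings (u @ v) = map ((`) (word_perm (rev v))) (crossings u) @ crossings v"
  by (induction u) (auto simp: word_perm_append)

lemma set_crossings_distinct:
  "distinct (crossings a) \<Longrightarrow> set (crossings a) = crossed (word_perm a)"
proof (induction a)
  case Nil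
  then show ?case by (auto simp: crossed_def)
next
  case (Cons x v)
  then show ?case
    unfolding crossed_word_perm_Cons by simp
qed

lemma card_crossed_word_perm:
  "finite (crossed (word_perm a)) \<and> card (crossed (word_perm a)) \<le> length a
    \<and> (\<not> distinct (crossings a) \<longrightarrow> card (crossed (word_perm a)) < length a)"
proof (induction a)
  case Nil
  have "crossed (\<lambda>i. i) = {}" by (auto simp: crossed_def)
  then show ?case by (simp add: id_def)
next
  case (Cons x v)
  let ?C = "{word_perm (rev v) x, word_perm (rev v) (x + 1)}"
  show ?case
  proof (cases "?C \<in> crossed (word_perm v)")
    case True
    then have "card (crossed (word_perm v) - {?C}) < card (crossed (word_perm v))"
      using Cons by (meson card_Diff1_less)
    then show ?thesis
      using Cons True unfolding crossed_word_perm_Cons by auto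
  next
    case False
    have "card (insert ?C (crossed (word_perm v))) \<le> Suc (card (crossed (word_perm v)))"
      by (simp add: card_insert_le_m1 card_insert_if)
    then show ?thesis
      using Cons False set_crossings_distinct[of v] unfolding crossed_word_perm_Cons
      by auto
  qed
qed

text \<open>A word is reduced iff no two wires cross twice: prepending a letter toggles exactly one
  inversion, so the length drops below the number of letters as soon as a pair is repeated.\<close>

lemma reduced_iff_distinct:
  "reduced a \<longleftrightarrow> (\<forall>x\<in>set a. 1 \<le> x) \<and> distinct (crossings a)"
proof -
  have "length a = perm_length (word_perm a) \<longleftrightarrow> distinct (crossings a)" if "\<forall>x\<in>set a. 1 \<le> x"
  proof -
    have len: "perm_length (word_perm a) = card (crossed (word_perm a))"
      using perm_length_eq_card_crossed word_perm_permutes that by blast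
    show ?thesis
    proof (cases "distinct (crossings a)")
      case True
      then have "card (crossed (word_perm a)) = length a"
        using set_crossings_distinct[OF True] distinct_card[OF True] by simp
      then show ?thesis using True len by simp
    next
      case False
      then show ?thesis using card_crossed_word_perm[of a] len by auto
    qed
  qed
  then show ?thesis by (auto simp: reduced_def)
qed

lemma set_crossings_reduced: "reduced a \<Longrightarrow> set (crossings a) = crossed (word_perm a)"
  by (simp add: reduced_iff_distinct set_crossings_distinct)

lemma reduced_append: "reduced (u @ v) \<Longrightarrow> reduced v"
  by (auto simp: reduced_iff_distinct crossings_append)

text \<open>In a reduced word no crossing is undone further to the left.\<close>

lemma reduced_crossed_suffix:
  "reduced (u @ v) \<Longrightarrow> crossed (word_perm v) \<subseteq> crossed (word_perm (u @ v))"
  by (metis Un_upper2 crossings_append reduced_append set_append set_crossings_reduced)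

lemma reduced_Cons_less:
  assumes "reduced (x # v)"
  shows "word_perm (rev v) x < word_perm (rev v) (x + 1)"
proof (rule ccontr)
  let ?C = "{word_perm (rev v) x, word_perm (rev v) (x + 1)}"
  assume "\<not> ?thesis"
  then have "?C \<in> crossed (word_perm v)"
    unfolding pair_in_crossed
    by (metis add_cancel_right_right less_add_one linorder_neqE_linordered_idom word_perm_cancel_rev
      word_perm_eq_iff zero_neq_one)
  moreover have "reduced v" using reduced_append[of "[x]" v] assms by simp
  ultimately show False
    using assms set_crossings_reduced[of v] by (auto simp: reduced_iff_distinct)
qed

section \<open>Columns of a word\<close>

text \<open>The wires just right of a column, by position. Lemmas count columns from 0, so that the column
  called \<open>t\<close> in the algorithms is written \<open>Suc i\<close>.\<close>

definition column_label :: "int list \<Rightarrow> nat \<Rightarrow> int \<Rightarrow> int" where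
  "column_label a i = word_perm (rev (drop (Suc i) a))"

abbreviation lower_wire :: "int list \<Rightarrow> nat \<Rightarrow> int" where
  "lower_wire a i \<equiv> column_label a i (a ! i)"

abbreviation upper_wire :: "int list \<Rightarrow> nat \<Rightarrow> int" where
  "upper_wire a i \<equiv> column_label a i (a ! i + 1)"

lemma column_label_eq_iff [simp]: "column_label a i x = column_label a i y \<longleftrightarrow> x = y"
  by (simp add: column_label_def)

lemma word_at_column: "i < length a \<Longrightarrow> a = take i a @ a ! i # drop (Suc i) a"
  by (rule id_take_nth_drop)

lemma nth_crossings: "i < length a \<Longrightarrow> crossings a ! i = {lower_wire a i, upper_wire a i}"
proof -
  assume i: "i < length a"
  then have "crossings a =
      map ((`) (word_perm (rev (a ! i # drop (Suc i) a)))) (crossings (take i a)) @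
      {lower_wire a i, upper_wire a i} # crossings (drop (Suc i) a)"
    using crossings_append[of "take i a" "a ! i # drop (Suc i) a"] word_at_column[OF i]
    by (simp add: column_label_def)
  then show ?thesis
    using i by (simp add: nth_append)
qed

lemma crossing_eq_nth_crossings: "i < length a \<Longrightarrow> crossing a (Suc i) = crossings a ! i"
  by (simp add: crossing_def nth_crossings column_label_def Let_def)

lemma delete_col_Suc: "delete_col (Suc i) a = take i a @ drop (Suc i) a"
  by (simp add: delete_col_def)

lemma length_delete_col [simp]: "i < length a \<Longrightarrow> length (delete_col (Suc i) a) = length a - 1"
  by (simp add: delete_col_Suc)

lemma nearly_reduced_Suc: "nearly_reduced a (Suc i) \<longleftrightarrow> i < length a \<and> reduced (delete_col (Suc i) a)"
  by (auto simp: nearly_reduced_def)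

lemma word_perm_delete_col:
  assumes "i < length a"
  shows "word_perm a =
    word_perm (delete_col (Suc i) a) \<circ> transpose (lower_wire a i) (upper_wire a i)"
  using word_perm_insert[of "take i a" "a ! i" "drop (Suc i) a"] word_at_column[OF assms]
  by (simp add: delete_col_Suc column_label_def)

lemma transpose_pair_cong: "{c, d} = {e, f} \<Longrightarrow> transpose c d = transpose e f"
  by (auto simp: doubleton_eq_iff transpose_commute)

lemma word_perm_delete_col':
  assumes "i < length a" "crossings a ! i = {c, d}"
  shows "word_perm (delete_col (Suc i) a) = word_perm a \<circ> transpose c d"
proof -
  have "transpose (lower_wire a i) (upper_wire a i) = transpose c d"
    using assms nth_crossings by (intro transpose_pair_cong) simp
  then show ?thesis
    using word_perm_delete_col[OF assms(1)] by (simp add: comp_assoc)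
qed

lemma reduced_lower_less_upper:
  assumes "reduced a" "i < length a"
  shows "lower_wire a i < upper_wire a i"
  using assms reduced_append[of "take i a" "a ! i # drop (Suc i) a"] word_at_column[OF assms(2)]
    reduced_Cons_less
  by (metis column_label_def)

lemma crossings_eq_parts:
  assumes "i < length a"
  defines "\<omega> \<equiv> column_label a i"
  shows "crossings a = map ((`) (\<omega> \<circ> simple_transp (a ! i))) (crossings (take i a)) @
           {\<omega> (a ! i), \<omega> (a ! i + 1)} # crossings (drop (Suc i) a)"
    and "crossings (delete_col (Suc i) a) =
           map ((`) \<omega>) (crossings (take i a)) @ crossings (drop (Suc i) a)"
  using crossings_append[of "take i a" "a ! i # drop (Suc i) a"] word_at_column[OF assms(1)]
  by (simp_all add: word_perm_append \<omega>_def delete_col_Suc crossings_append column_label_def)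

lemma crossings_delete_col:
  assumes "i < length a"
  shows "crossings (delete_col (Suc i) a) =
    map ((`) (transpose (lower_wire a i) (upper_wire a i))) (take i (crossings a)) @
    drop (Suc i) (crossings a)"
proof -
  let ?\<omega> = "column_label a i" and ?x = "a ! i"
  have "transpose (?\<omega> ?x) (?\<omega> (?x + 1)) \<circ> (?\<omega> \<circ> simple_transp ?x) = ?\<omega>"
  proof -
    have "?\<omega> \<circ> simple_transp ?x = transpose (?\<omega> ?x) (?\<omega> (?x + 1)) \<circ> ?\<omega>"
      unfolding simple_transp_def
      by (rule inj_comp_transpose) (simp add: column_label_def inj_word_perm)
    then show ?thesis by (simp add: fun_eq_iff)
  qed
  then have im: "transpose (?\<omega> ?x) (?\<omega> (?x + 1)) ` (?\<omega> \<circ> simple_transp ?x) ` P = ?\<omega> ` P" for P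
    by (metis image_comp)
  have "take i (crossings a) = map ((`) (?\<omega> \<circ> simple_transp ?x)) (crossings (take i a))"
    and "drop (Suc i) (crossings a) = crossings (drop (Suc i) a)"
    using assms by (simp_all add: crossings_eq_parts(1)[OF assms])
  then show ?thesis
    using crossings_eq_parts(2)[OF assms] im by (simp add: comp_def)
qed

text \<open>Two columns on the same side of a deleted column \<open>k\<close> are relabeled in the same way, so a crossing
  that they share would stay repeated.\<close>

lemma repeated_crossing_straddles:
  assumes red: "reduced (delete_col (Suc k) a)" and "k < length a"
    and "i < j" "j < length a" and eq: "crossings a ! i = crossings a ! j"
  shows "i \<le> k \<and> k \<le> j"
proof (rule ccontr)
  assume neg: "\<not> ?thesis"
  have dist: "distinct (crossings (delete_col (Suc k) a))"
    using red by (simp add: reduced_iff_distinct)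
  have "inj_on ((`) f) A" if "inj f" for f :: "int \<Rightarrow> int" and A
    using that by (simp add: inj_on_def inj_image_eq_iff)
  then have dl: "distinct (take k (crossings a))" and dr: "distinct (drop (Suc k) (crossings a))"
    using dist unfolding crossings_delete_col[OF assms(2)]
    by (auto simp: distinct_map)
  show False
  proof (cases "k < i")
    case True
    then have "drop (Suc k) (crossings a) ! (i - Suc k) = drop (Suc k) (crossings a) ! (j - Suc k)"
      using eq assms by simp
    then show False
      using True assms(3,4) nth_eq_iff_index_eq[OF dr, of "i - Suc k" "j - Suc k"]
      by (simp add: diff_less_mono Suc_leI)
  next
    case False
    then have "j < k" using neg assms by auto
    then show False
      using nth_eq_iff_index_eq[OF dl, of i j] eq assms by auto
  qed
qed

section \<open>The defect of a nearly reduced word\<close>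

text \<open>Suppose wires \<open>c\<close> and \<open>d\<close> are neighbours after the suffix \<open>V\<close> of a reduced word for \<open>W\<close>,
  and \<open>W\<close> does not invert them. Then no wire \<open>f\<close> crosses one of them within \<open>V\<close> and the other one
  only later: being on the same side of both, \<open>f\<close> would have to cross one of them twice.\<close>

lemma no_split_crossing:
  assumes sub: "crossed V \<subseteq> crossed W" and "inj V" "inj W"
    and adj: "{V c, V d} = {x, x + 1}" and notW: "{c, d} \<notin> crossed W"
    and cf: "{c, f} \<in> crossed V" and df: "{d, f} \<in> crossed W" "{d, f} \<notin> crossed V"
  shows False
proof -
  have ne: "f \<noteq> c" "f \<noteq> d" "c \<noteq> d"
    using cf df adj by (auto simp: pair_in_crossed doubleton_eq_iff)
  then have V: "V f \<noteq> V c" "V f \<noteq> V d" and W: "W c \<noteq> W d" "W f \<noteq> W c" "W f \<noteq> W d"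
    using assms(2,3) by (simp_all add: inj_eq)
  have notV: "{c, d} \<notin> crossed V" and cfW: "{c, f} \<in> crossed W"
    using sub notW cf by auto
  have "V c = x \<and> V d = x + 1 \<or> V d = x \<and> V c = x + 1"
    using adj by (auto simp: doubleton_eq_iff)
  then show False
    using cf df notV notW cfW V W ne unfolding pair_in_crossed by (smt (verit))
qed

text \<open>Some crossing of \<open>a\<close> is repeated. If it is not that of column \<open>i\<close>, its two occurrences lie on
  both sides of \<open>i\<close>, and deleting column \<open>i\<close> relabels one wire of the left one. This is the situation
  excluded above, unless the wires meeting in column \<open>i\<close> cross elsewhere, too.\<close>

lemma crossing_repeated_if_not_reduced:
  assumes red: "reduced (delete_col (Suc i) a)" and i: "i < length a"
    and pos: "\<forall>x\<in>set a. 1 \<le> x" and nred: "\<not> reduced a"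
  shows "\<exists>j. j \<noteq> i \<and> j < length a \<and> crossings a ! j = crossings a ! i"
proof (rule ccontr)
  assume neg: "\<not> ?thesis"
  define c where "c = lower_wire a i"
  define d where "d = upper_wire a i"
  let ?t = "transpose c d"
  let ?u = "take i a" and ?v = "drop (Suc i) a"
  have cri: "crossings a ! i = {c, d}"
    using nth_crossings[OF i] by (simp add: c_def d_def)
  obtain k l where kl: "k < l" "l < length a" "crossings a ! k = crossings a ! l"
    using nred pos unfolding reduced_iff_distinct distinct_conv_nth
    by (metis length_crossings linorder_neqE_nat)
  have "k \<le> i \<and> i \<le> l"
    using repeated_crossing_straddles[OF red i kl] .
  then have "k < i" "i < l"
    using kl neg i by (metis le_neq_implies_less less_trans)+
  define P where "P = crossings a ! l"
  have Pv: "P \<in> set (drop (Suc i) (crossings a))"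
  proof -
    have "drop (Suc i) (crossings a) ! (l - Suc i) = P"
      using \<open>i < l\<close> kl(2) by (simp add: P_def)
    then show ?thesis
      using \<open>i < l\<close> kl(2) nth_mem[of "l - Suc i" "drop (Suc i) (crossings a)"] by simp
  qed
  have tP: "?t ` P \<in> set (map ((`) ?t) (take i (crossings a)))"
  proof -
    have "P \<in> set (take i (crossings a))"
      using \<open>k < i\<close> i kl(3) nth_mem[of k "take i (crossings a)"] by (simp add: P_def)
    then show ?thesis by simp
  qed
  have redv: "reduced ?v"
    using red unfolding delete_col_Suc by (rule reduced_append)
  have drop_cr: "drop (Suc i) (crossings a) = crossings ?v"
    using i by (simp add: crossings_eq_parts(1)[OF i])
  let ?V = "word_perm ?v" and ?W = "word_perm (delete_col (Suc i) a)"
  have setV: "set (crossings ?v) = crossed ?V"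
    using set_crossings_reduced[OF redv] .
  have setW: "set (crossings (delete_col (Suc i) a)) = crossed ?W"
    using set_crossings_reduced[OF red] .
  have parts: "crossings (delete_col (Suc i) a) =
      map ((`) ?t) (take i (crossings a)) @ crossings ?v"
    using crossings_delete_col[OF i] drop_cr by (simp add: c_def d_def)
  have PV: "P \<in> crossed ?V" using Pv drop_cr setV by simp
  have tPW: "?t ` P \<in> crossed ?W" using tP parts setW by auto
  have tPV: "?t ` P \<notin> crossed ?V"
    using tP parts red setV unfolding reduced_iff_distinct by auto
  have sub: "crossed ?V \<subseteq> crossed ?W"
    using reduced_crossed_suffix red unfolding delete_col_Suc by blast
  have cdW: "{c, d} \<notin> crossed ?W"
  proof
    assume "{c, d} \<in> crossed ?W"
    then consider "{c, d} \<in> set (map ((`) ?t) (take i (crossings a)))" | "{c, d} \<in> set (crossings ?v)"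
      using setW parts by auto
    then show False
    proof cases
      case 1
      then obtain m where m: "m < i" "{c, d} = ?t ` (crossings a ! m)"
        using i by (auto simp: in_set_conv_nth)
      then have "?t ` {c, d} = ?t ` ?t ` (crossings a ! m)" by simp
      then have "crossings a ! m = {c, d}"
        by (simp add: image_comp insert_commute)
      then show False using neg m(1) i cri by (metis less_trans nat_neq_iff)
    next
      case 2
      then obtain m where "m < length ?v" "crossings a ! (Suc i + m) = {c, d}"
        unfolding drop_cr[symmetric] by (auto simp: in_set_conv_nth)
      then show False using neg cri by (auto dest: spec[of _ "Suc i + m"])
    qed
  qed
  have adj: "{?V c, ?V d} = {a ! i, a ! i + 1}" and adj': "{?V d, ?V c} = {a ! i, a ! i + 1}"
    by (auto simp: c_def d_def column_label_def)
  obtain e f where ef: "P = {e, f}"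
    using PV unfolding crossed_def by auto
  have cond: "e \<in> {c, d} \<or> f \<in> {c, d}"
  proof (rule ccontr)
    assume "\<not> ?thesis"
    then have "?t ` P = P" using ef by (auto simp: transpose_def)
    then show False using tPV PV by simp
  qed
  have nb: "P \<noteq> {c, d}" using sub PV cdW by auto
  have "\<exists>f. (P = {c, f} \<or> P = {d, f}) \<and> f \<noteq> c \<and> f \<noteq> d"
  proof -
    have "e \<noteq> f" using ef PV by (auto simp: pair_in_crossed)
    then show ?thesis using cond nb ef by (auto simp: insert_commute)
  qed
  then obtain f where f: "P = {c, f} \<or> P = {d, f}" "f \<noteq> c" "f \<noteq> d" by auto
  show False
  proof (cases "P = {c, f}")
    case True
    then have "?t ` P = {d, f}" using f by (auto simp: transpose_def)
    then show False
      using no_split_crossing[OF sub inj_word_perm inj_word_perm adj cdW] True PV tPW tPV by simp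
  next
    case False
    then have P: "P = {d, f}" using f by simp
    have cdW': "{d, c} \<notin> crossed ?W" using cdW by (simp add: insert_commute)
    have "?t ` P = {c, f}" using f P by (auto simp: transpose_def)
    then show False
      using no_split_crossing[OF sub inj_word_perm inj_word_perm adj' cdW'] P PV tPW tPV by simp
  qed
qed

lemma delete_repeated_crossing:
  assumes "i < length a" "j < length a" "crossings a ! j = crossings a ! i"
  shows "word_perm (delete_col (Suc j) a) = word_perm (delete_col (Suc i) a)"
  using word_perm_delete_col'[OF assms(1)] word_perm_delete_col'[OF assms(2)] nth_crossings assms
  by metis

lemma set_delete_col: "set (delete_col (Suc i) a) \<subseteq> set a"
  by (auto simp: delete_col_Suc dest: in_set_takeD in_set_dropD)

text \<open>Deleting either column of a repeated crossing gives the same permutation and the same number of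
  letters, and these two decide reducedness.\<close>

lemma reduced_delete_repeated_crossing:
  assumes "reduced (delete_col (Suc i) a)" "\<forall>x\<in>set a. 1 \<le> x"
    and "i < length a" "j < length a" "crossings a ! j = crossings a ! i"
  shows "reduced (delete_col (Suc j) a)"
  using assms delete_repeated_crossing[OF assms(3-5)] set_delete_col[of j a]
  unfolding reduced_def by auto

text \<open>Uniqueness of the defect: each of two columns carrying the same crossing lies weakly between
  the two columns of any other repeated crossing, which cannot hold for both pairs.\<close>

lemma repeated_crossing_unique:
  assumes red: "reduced (delete_col (Suc i) a)" and pos: "\<forall>x\<in>set a. 1 \<le> x" and nred: "\<not> reduced a"
    and i: "i < length a" and j: "j < length a" "j \<noteq> i" "crossings a ! j = crossings a ! i"
    and k: "k < length a" "k \<noteq> i" "reduced (delete_col (Suc k) a)"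
  shows "k = j"
proof (rule ccontr)
  assume "k \<noteq> j"
  have redj: "reduced (delete_col (Suc j) a)"
    using reduced_delete_repeated_crossing[OF red pos i j(1,3)] .
  obtain l where l: "l \<noteq> k" "l < length a" "crossings a ! l = crossings a ! k"
    using crossing_repeated_if_not_reduced[OF k(3,1) pos nred] by auto
  have between: "min m n \<le> q \<and> q \<le> max m n"
    if "reduced (delete_col (Suc q) a)" "q < length a" "m < length a" "n < length a" "m \<noteq> n"
       "crossings a ! m = crossings a ! n" for m n q
  proof (cases "m < n")
    case True
    then show ?thesis using repeated_crossing_straddles[OF that(1,2) True that(4,6)] by auto
  next
    case False
    then have "n < m" using that by simp
    then show ?thesis
      using repeated_crossing_straddles[OF that(1,2) _ that(3)] that(6) by auto
  qed
  have "min i j \<le> k \<and> k \<le> max i j" using between[OF k(3,1) i j(1)] j by auto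
  moreover have "min k l \<le> i \<and> i \<le> max k l" using between[OF red i k(1) l(2)] l by auto
  moreover have "min k l \<le> j \<and> j \<le> max k l" using between[OF redj j(1) k(1) l(2)] l by auto
  ultimately show False
    using \<open>k \<noteq> j\<close> k(2) j(2) by (auto simp: min_def max_def split: if_splits)
qed

text \<open>Read from the right, the wires of the pair enter column \<open>j\<close> in the order of their labels, since
  the suffix right of column \<open>i\<close> is reduced; they leave it inverted, and stay so up to column \<open>i\<close>.\<close>

lemma repeated_crossing_reverses:
  assumes red: "reduced (delete_col (Suc i) a)" and "i < j" "j < length a"
    and eq: "crossings a ! j = crossings a ! i"
  shows "lower_wire a j = upper_wire a i \<and> upper_wire a j = lower_wire a i"
proof -
  let ?v = "drop (Suc i) a"
  define m where "m = j - Suc i"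
  have redv: "reduced ?v"
    using red unfolding delete_col_Suc by (rule reduced_append)
  have m: "m < length ?v" "?v ! m = a ! j" "column_label ?v m = column_label a j"
    using assms(2,3) by (auto simp: m_def column_label_def)
  then have less: "lower_wire a j < upper_wire a j"
    using reduced_lower_less_upper[OF redv m(1)] by simp
  have pair: "{lower_wire a j, upper_wire a j} = {lower_wire a i, upper_wire a i}"
    using nth_crossings[of j a] nth_crossings[of i a] eq assms(2,3) by simp
  have "{lower_wire a i, upper_wire a i} \<in> crossed (word_perm ?v)"
    using pair m nth_crossings[OF m(1)] set_crossings_reduced[OF redv]
    by (metis length_crossings nth_mem)
  then have "upper_wire a i < lower_wire a i"
    unfolding pair_in_crossed by (simp add: column_label_def)
  then show ?thesis using pair less by (auto simp: doubleton_eq_iff)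
qed

text \<open>All that a bumping run needs when it moves to the defect; the last conclusion serves to recognize
  the defect without computing crossings.\<close>

lemma defect_properties:
  assumes red: "reduced (delete_col (Suc i) a)" and i: "i < length a"
    and pos: "\<forall>x\<in>set a. 1 \<le> x" and nred: "\<not> reduced a"
  obtains j where "defect (Suc i) a = Suc j" "j < length a" "j \<noteq> i" "defect (Suc j) a = Suc i"
    "reduced (delete_col (Suc j) a)"
    "word_perm (delete_col (Suc j) a) = word_perm (delete_col (Suc i) a)"
    "lower_wire a j = upper_wire a i" "upper_wire a j = lower_wire a i"
    "\<forall>k. k \<noteq> i \<longrightarrow> nearly_reduced a (Suc k) \<longrightarrow> k = j"
proof -
  obtain j where j: "j \<noteq> i" "j < length a" "crossings a ! j = crossings a ! i"
    using crossing_repeated_if_not_reduced[OF assms] by auto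
  have redj: "reduced (delete_col (Suc j) a)"
    using reduced_delete_repeated_crossing[OF red pos i j(2,3)] .
  have uniq: "\<forall>k. k \<noteq> i \<longrightarrow> nearly_reduced a (Suc k) \<longrightarrow> k = j"
    using repeated_crossing_unique[OF red pos nred i j(2,1,3)] by (simp add: nearly_reduced_Suc)
  have uniq': "k = i" if "k \<noteq> j" "nearly_reduced a (Suc k)" for k
    using repeated_crossing_unique[OF redj pos nred j(2) i j(1)[symmetric] j(3)[symmetric]] that
    by (simp add: nearly_reduced_Suc)
  have "defect (Suc i) a = Suc j" unfolding defect_def
  proof (rule the_equality)
    show "Suc j \<noteq> Suc i \<and> nearly_reduced a (Suc j)"
      using j redj by (simp add: nearly_reduced_Suc)
    show "t = Suc j" if "t \<noteq> Suc i \<and> nearly_reduced a t" for t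
      using that uniq by (cases t) (auto simp: nearly_reduced_def)
  qed
  moreover have "defect (Suc j) a = Suc i" unfolding defect_def
  proof (rule the_equality)
    show "Suc i \<noteq> Suc j \<and> nearly_reduced a (Suc i)"
      using j i red by (simp add: nearly_reduced_Suc)
    show "t = Suc i" if "t \<noteq> Suc j \<and> nearly_reduced a t" for t
      using that uniq' by (cases t) (auto simp: nearly_reduced_def)
  qed
  moreover have "lower_wire a j = upper_wire a i \<and> upper_wire a j = lower_wire a i"
  proof (cases "i < j")
    case True
    then show ?thesis using repeated_crossing_reverses[OF red True j(2,3)] by simp
  next
    case False
    then have "j < i" using j by simp
    then show ?thesis using repeated_crossing_reverses[OF redj _ i j(3)[symmetric]] by simp
  qed
  ultimately show ?thesis
    using that j redj uniq delete_repeated_crossing[OF i j(2,3)] by blast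
qed

section \<open>Bumping is reversible\<close>

text \<open>This bounds the letters of all reduced words of a fixed permutation, and so makes upward bumping
  terminate. The argument is by induction from the right: if prepending \<open>z\<close> left no point above \<open>x\<close>
  moved, then \<open>x \<le> z\<close>, and either the factor \<open>s\<^sub>z\<close> undoes a crossing, or \<open>x = z\<close> and the wire in
  position \<open>z + 1\<close> is one from above \<open>z + 1\<close>, which was to be left in its place.\<close>

lemma reduced_letter_moves:
  "reduced a \<Longrightarrow> x \<in> set a \<Longrightarrow> \<exists>y>x. word_perm a y \<noteq> y"
proof (induction a)
  case Nil
  then show ?case by simp
next
  case (Cons z v)
  let ?V = "word_perm v" and ?W = "word_perm (z # v)"
  have less: "word_perm (rev v) z < word_perm (rev v) (z + 1)"
    using reduced_Cons_less[OF Cons.prems(1)] .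
  have redv: "reduced v" using reduced_append[of "[z]" v] Cons.prems(1) by simp
  have V: "?V y = simple_transp z y" if "?W y = y" for y
    using that by (metis comp_apply simple_transp_involutive word_perm_Cons)
  show ?case
  proof (rule ccontr)
    assume "\<not> ?thesis"
    then have step: "?V y = simple_transp z y" if "x < y" for y
      using that V by blast
    have R: "word_perm (rev v) (simple_transp z y) = y" if "x < y" for y
      using step[OF that] by (metis word_perm_rev_cancel)
    consider "x < z" | "x = z" | "z < x" by linarith
    then show False
    proof cases
      case 1
      then show False
        using R[of z] R[of "z + 1"] less by (simp add: simple_transp_def)
    next
      case 2
      then have 1: "word_perm (rev v) z = z + 1"
        using R[of "z + 1"] by (simp add: simple_transp_def)
      define w where "w = word_perm (rev v) (z + 1)"
      have "z + 1 < w" using less 1 w_def by simp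
      then have "?V w = w" using step[of w] 2 by (simp add: simple_transp_def transpose_def)
      moreover have "?V w = z + 1" by (simp add: w_def)
      ultimately show False using \<open>z + 1 < w\<close> by simp
    next
      case 3
      then have "x \<in> set v" using Cons.prems by auto
      then obtain y where y: "x < y" "?V y \<noteq> y" using Cons.IH redv by blast
      then have "simple_transp z y = y" using 3 by (simp add: simple_transp_def transpose_def)
      then show False using y step by simp
    qed
  qed
qed

text \<open>The part of the bumping loop that follows a push. A run in the opposite direction enters the loop
  at this point when it has undone a push, which is how its agreement with the original run is
  expressed.\<close>

definition bump_check ::
  "int \<Rightarrow> nat \<Rightarrow> int list \<Rightarrow> int list \<Rightarrow> (int list \<times> int list \<times> int \<times> nat \<times> outcome) option"
where
  "bump_check \<epsilon> t a b =
     (if b ! (t - 1) = 0 then Some (delete_col t a, delete_col t b, a ! (t - 1), t, Deleted)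
      else if reduced a then Some (a, b, a ! (t - 1), t, Bumped)
      else bounded_bump \<epsilon> (defect t a) a b)"

lemma bounded_bump_push: "bounded_bump \<epsilon> t a b = bump_check \<epsilon> t (push \<epsilon> t a) (push \<epsilon> t b)"
  by (subst bounded_bump.simps) (simp add: bump_check_def Let_def)

lemma push_Suc: "push \<epsilon> (Suc i) a = a[i := a ! i + \<epsilon>]"
  by (simp add: push_def)

lemma length_push [simp]: "length (push \<epsilon> t a) = length a"
  by (simp add: push_def)

lemma delete_col_push [simp]: "delete_col (Suc i) (push \<epsilon> (Suc i) a) = delete_col (Suc i) a"
  by (simp add: delete_col_Suc push_Suc)

lemma push_push_cancel [simp]: "push (- \<epsilon>) (Suc i) (push \<epsilon> (Suc i) a) = a"
  by (cases "i < length a") (simp_all add: push_Suc list_update_beyond)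

lemma column_label_push [simp]: "column_label (push \<epsilon> (Suc i) a) i = column_label a i"
  by (simp add: column_label_def push_Suc)

lemma nth_push [simp]: "i < length a \<Longrightarrow> push \<epsilon> (Suc i) a ! i = a ! i + \<epsilon>"
  by (simp add: push_Suc)

lemma nth_push_other [simp]: "k \<noteq> i \<Longrightarrow> push \<epsilon> (Suc i) a ! k = a ! k"
  by (simp add: push_Suc)

lemma sum_list_push: "i < length a \<Longrightarrow> sum_list (push \<epsilon> (Suc i) a) = sum_list a + \<epsilon>"
  for a :: "int list"
proof -
  assume i: "i < length a"
  have "sum_list (take i a @ a ! i # drop (Suc i) a) =
      sum_list (take i a) + (a ! i + sum_list (drop (Suc i) a))" by simp
  then have "sum_list a = sum_list (take i a) + (a ! i + sum_list (drop (Suc i) a))"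
    using word_at_column[OF i] by metis
  then show ?thesis
    using i by (simp add: push_Suc upd_conv_take_nth_drop)
qed

text \<open>The state of a run just before column \<open>i\<close> is pushed in direction \<open>\<epsilon>\<close>, and equally the state just
  after it has been pushed in direction \<open>- \<epsilon>\<close>. Throughout a bumping run, deleting the current
  column leaves a reduced word for the same permutation \<open>\<nu>\<close>, and the same wire \<open>r\<close> passes through
  the current crossing: right of it, \<open>r\<close> is the lower of the two wires before a push down and the
  upper one before a push up. The entry \<open>b\<^sub>i\<close> may vanish only before a push up, when
  it has just been lowered or inserted.\<close>

definition bump_state ::
  "(int \<Rightarrow> int) \<Rightarrow> int \<Rightarrow> int \<Rightarrow> nat \<Rightarrow> int list \<Rightarrow> int list \<Rightarrow> bool" where
  "bump_state \<nu> r \<epsilon> i a b \<longleftrightarrow>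
     i < length a \<and> length b = length a \<and>
     reduced (delete_col (Suc i) a) \<and> word_perm (delete_col (Suc i) a) = \<nu> \<and>
     (if \<epsilon> = 1 then upper_wire a i else lower_wire a i) = r \<and>
     (\<forall>k < length a. (if k = i \<and> \<epsilon> = 1 then 0 else 1) \<le> b ! k \<and> b ! k \<le> a ! k)"

lemma bump_state_push:
  assumes "bump_state \<nu> r \<epsilon> i a b" "\<epsilon> \<in> {1, - 1}"
  shows "bump_state \<nu> r (- \<epsilon>) i (push \<epsilon> (Suc i) a) (push \<epsilon> (Suc i) b)"
proof -
  have i: "i < length a" "length b = length a"
    and bnd: "\<And>k. k < length a \<Longrightarrow> (if k = i \<and> \<epsilon> = 1 then 0 else 1) \<le> b ! k \<and> b ! k \<le> a ! k"
    and wire: "(if \<epsilon> = 1 then upper_wire a i else lower_wire a i) = r"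
    using assms(1) by (simp_all add: bump_state_def)
  have "(if k = i \<and> - \<epsilon> = 1 then 0 else 1) \<le> push \<epsilon> (Suc i) b ! k \<and>
      push \<epsilon> (Suc i) b ! k \<le> push \<epsilon> (Suc i) a ! k" if k: "k < length a" for k
    using bnd[OF k] i assms(2) by (cases "k = i") (auto split: if_splits)
  moreover have "(if - \<epsilon> = 1 then upper_wire (push \<epsilon> (Suc i) a) i
      else lower_wire (push \<epsilon> (Suc i) a) i) = r"
    using wire i assms(2) by auto
  ultimately show ?thesis
    using assms(1) by (simp add: bump_state_def)
qed

lemma bump_state_defect:
  assumes st: "bump_state \<nu> r (- \<epsilon>) i a b" and \<epsilon>: "\<epsilon> \<in> {1, - 1}"
    and "b ! i \<noteq> 0" and nred: "\<not> reduced a"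
  obtains j where "defect (Suc i) a = Suc j" "defect (Suc j) a = Suc i" "bump_state \<nu> r \<epsilon> j a b"
    "j \<noteq> i" "\<forall>k. k \<noteq> i \<longrightarrow> nearly_reduced a (Suc k) \<longrightarrow> k = j"
proof -
  have b: "1 \<le> b ! k \<and> b ! k \<le> a ! k" if "k < length a" for k
    using st \<open>b ! i \<noteq> 0\<close> that unfolding bump_state_def
    by (cases "k = i") (auto split: if_splits)
  have pos: "\<forall>x\<in>set a. 1 \<le> x"
    using b by (metis in_set_conv_nth order_trans)
  have red: "reduced (delete_col (Suc i) a)" "i < length a"
    using st by (auto simp: bump_state_def)
  obtain j where j: "defect (Suc i) a = Suc j" "j < length a" "j \<noteq> i" "defect (Suc j) a = Suc i"
    "reduced (delete_col (Suc j) a)"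
    "word_perm (delete_col (Suc j) a) = word_perm (delete_col (Suc i) a)"
    "lower_wire a j = upper_wire a i" "upper_wire a j = lower_wire a i"
    "\<forall>k. k \<noteq> i \<longrightarrow> nearly_reduced a (Suc k) \<longrightarrow> k = j"
    by (rule defect_properties[OF red pos nred])
  have "bump_state \<nu> r \<epsilon> j a b"
  proof -
    have "(if k = j \<and> \<epsilon> = 1 then 0 else 1) \<le> b ! k \<and> b ! k \<le> a ! k" if "k < length a" for k
      using b[OF that] by auto
    moreover have "(if \<epsilon> = 1 then upper_wire a j else lower_wire a j) = r"
      using st j(7,8) \<epsilon> unfolding bump_state_def by auto
    ultimately show ?thesis
      using st j(2,5,6) unfolding bump_state_def by simp
  qed
  then show ?thesis using that j by blast
qed

lemma bump_state_letter_bound: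
  assumes "bump_state \<nu> r \<epsilon> i a b" "\<forall>y>N. \<nu> y = y" "k < length a" "k \<noteq> i"
  shows "a ! k \<le> N"
proof -
  have "a ! k \<in> set (delete_col (Suc i) a)"
  proof (cases "k < i")
    case True
    then show ?thesis
      using assms nth_mem[of k "take i a"] by (simp add: delete_col_Suc)
  next
    case False
    then have "i < k" using assms by simp
    then show ?thesis
      using assms nth_mem[of "k - Suc i" "drop (Suc i) a"] by (simp add: delete_col_Suc)
  qed
  then obtain y where "a ! k < y" "\<nu> y \<noteq> y"
    using assms reduced_letter_moves unfolding bump_state_def by metis
  then show ?thesis using assms(2) by (metis not_less order.strict_trans2 nle_le)
qed

lemma sum_list_le_length_mult:
  fixes N :: int
  assumes "\<forall>k < length a. a ! k \<le> N"
  shows "sum_list a \<le> int (length a) * N"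
proof -
  have "\<forall>x\<in>set a. x \<le> N" using assms by (metis in_set_conv_nth)
  then show ?thesis by (induction a) (auto simp: algebra_simps)
qed

text \<open>Bumping is reversible because pushing is undone by the opposite push, and moving to the defect is
  an involution. So the opposite run from the final state passes through the same states and reaches the word with which
  the run began; whether it stops there depends on that word. The invariant \<open>J\<close> is arbitrary
  and will carry the row structure of pipe dreams.

  A downward run terminates because the sum of \<open>b\<close> decreases. In an upward run that goes on, all
  letters are letters of reduced words for \<open>\<nu>\<close>, hence bounded, while the sum of \<open>a\<close> increases.\<close>

lemma bounded_bump_reversible:
  assumes fin: "finite {y. \<nu> y \<noteq> y}" and \<epsilon>: "\<epsilon> \<in> {1, - 1}"
    and J_push: "\<And>i a b. J \<epsilon> i a b \<Longrightarrow> bump_state \<nu> r \<epsilon> i a b \<Longrightarrow>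
        J (- \<epsilon>) i (push \<epsilon> (Suc i) a) (push \<epsilon> (Suc i) b)"
    and J_defect: "\<And>i j a b. J (- \<epsilon>) i a b \<Longrightarrow> bump_state \<nu> r (- \<epsilon>) i a b \<Longrightarrow> b ! i \<noteq> 0 \<Longrightarrow>
        \<forall>k. k \<noteq> i \<longrightarrow> nearly_reduced a (Suc k) \<longrightarrow> k = j \<Longrightarrow> J \<epsilon> j a b"
    and "bump_state \<nu> r \<epsilon> i a b" and "J \<epsilon> i a b"
  shows "\<exists>j a' b'. bump_state \<nu> r (- \<epsilon>) j a' b' \<and> J (- \<epsilon>) j a' b' \<and> (b' ! j = 0 \<or> reduced a') \<and>
    length a' = length a \<and>
    bounded_bump \<epsilon> (Suc i) a b = bump_check \<epsilon> (Suc j) a' b' \<and>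
    bounded_bump (- \<epsilon>) (Suc j) a' b' = bump_check (- \<epsilon>) (Suc i) a b"
proof -
  have "finite (insert 0 {y. \<nu> y \<noteq> y})" using fin by simp
  then obtain N where N: "\<forall>y>N. \<nu> y = y"
    by (metis (mono_tags, lifting) Max_ge insertCI mem_Collect_eq not_less)
  \<comment> \<open>No letter exceeds \<open>N\<close> as long as the run goes on, so \<open>\<mu>\<close> drops with every push.\<close>
  define \<mu> where "\<mu> a b = nat (if \<epsilon> = 1 then int (length a) * N - sum_list a else sum_list b)"
    for a b :: "int list"
  show ?thesis
    using assms(5,6)
  proof (induction "\<mu> a b" arbitrary: i a b rule: less_induct)
    case less
    define a1 where "a1 = push \<epsilon> (Suc i) a"
    define b1 where "b1 = push \<epsilon> (Suc i) b"
    have i: "i < length a" "length b = length a" using less.prems by (auto simp: bump_state_def)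
    have st1: "bump_state \<nu> r (- \<epsilon>) i a1 b1"
      unfolding a1_def b1_def using bump_state_push[OF less.prems(1) \<epsilon>] .
    have J1: "J (- \<epsilon>) i a1 b1"
      unfolding a1_def b1_def using J_push less.prems by blast
    have fwd: "bounded_bump \<epsilon> (Suc i) a b = bump_check \<epsilon> (Suc i) a1 b1"
      by (simp add: bounded_bump_push a1_def b1_def)
    have bwd: "bounded_bump (- \<epsilon>) (Suc i) a1 b1 = bump_check (- \<epsilon>) (Suc i) a b"
      by (simp add: bounded_bump_push a1_def b1_def)
    have len: "length a1 = length a" by (simp add: a1_def)
    show ?case
    proof (cases "b1 ! i = 0 \<or> reduced a1")
      case True
      then show ?thesis using st1 J1 fwd bwd len by blast
    next
      case False
      then have "b1 ! i \<noteq> 0" "\<not> reduced a1" by auto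
      then obtain j where j: "defect (Suc i) a1 = Suc j" "defect (Suc j) a1 = Suc i"
        "bump_state \<nu> r \<epsilon> j a1 b1" "j \<noteq> i"
        "\<forall>k. k \<noteq> i \<longrightarrow> nearly_reduced a1 (Suc k) \<longrightarrow> k = j"
        by (rule bump_state_defect[OF st1 \<epsilon>])
      have J2: "J \<epsilon> j a1 b1" using J_defect[OF J1 st1 _ j(5)] False by blast
      have b1: "0 \<le> b1 ! k" if "k < length b1" for k
        using st1 that unfolding bump_state_def by (auto split: if_splits)
      have "sum_list b1 \<ge> 0" using b1 by (intro sum_list_nonneg) (metis in_set_conv_nth)
      moreover have "sum_list a1 \<le> int (length a1) * N"
      proof (rule sum_list_le_length_mult, intro allI impI)
        fix k assume k: "k < length a1"
        \<comment> \<open>The pushed letter itself belongs to the reduced word obtained by deleting the defect.\<close>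
        show "a1 ! k \<le> N"
        proof (cases "k = i")
          case True
          then show ?thesis using bump_state_letter_bound[OF j(3) N k] j(4) by simp
        next
          case False
          then show ?thesis using bump_state_letter_bound[OF st1 N k] by simp
        qed
      qed
      moreover have "sum_list a1 = sum_list a + \<epsilon>" "sum_list b1 = sum_list b + \<epsilon>"
        using i by (simp_all add: a1_def b1_def sum_list_push)
      ultimately have "\<mu> a1 b1 < \<mu> a b"
        using \<epsilon> len unfolding \<mu>_def by (auto simp: nat_less_iff)
      from less.hyps[OF this j(3) J2] obtain j' a' b' where
        IH: "bump_state \<nu> r (- \<epsilon>) j' a' b'" "J (- \<epsilon>) j' a' b'" "b' ! j' = 0 \<or> reduced a'"
        "length a' = length a1"
        "bounded_bump \<epsilon> (Suc j) a1 b1 = bump_check \<epsilon> (Suc j') a' b'"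
        "bounded_bump (- \<epsilon>) (Suc j') a' b' = bump_check (- \<epsilon>) (Suc j) a1 b1"
        by blast
      have "bounded_bump \<epsilon> (Suc i) a b = bounded_bump \<epsilon> (Suc j) a1 b1"
        using False j(1) by (simp add: fwd bump_check_def)
      moreover have "b1 ! j \<noteq> 0"
      proof -
        have "1 \<le> b1 ! j"
          using st1 j(3,4) unfolding bump_state_def by (auto split: if_splits)
        then show ?thesis by simp
      qed
      then have "bump_check (- \<epsilon>) (Suc j) a1 b1 = bump_check (- \<epsilon>) (Suc i) a b"
        using False j(2) bwd by (simp add: bump_check_def)
      ultimately show ?thesis using IH len by metis
    qed
  qed
qed

section \<open>Lengths and transpositions\<close>

lemma S_infinity_permutes: "\<pi> \<in> S_infinity \<Longrightarrow> \<pi> permutes {1..}"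
  and S_infinity_finite: "\<pi> \<in> S_infinity \<Longrightarrow> finite {i. \<pi> i \<noteq> i}"
  by (simp_all add: S_infinity_def)

lemma S_infinity_inj: "\<pi> \<in> S_infinity \<Longrightarrow> \<pi> i = \<pi> j \<longleftrightarrow> i = j"
  by (meson S_infinity_permutes injD permutes_inj)

lemma S_infinity_comp_transpose:
  assumes "\<pi> \<in> S_infinity" "1 \<le> c" "1 \<le> d"
  shows "\<pi> \<circ> transpose c d \<in> S_infinity"
proof -
  have "\<pi> \<circ> transpose c d permutes {1..}"
    using assms by (intro permutes_compose permutes_swap_id S_infinity_permutes) auto
  moreover have "{i. (\<pi> \<circ> transpose c d) i \<noteq> i} \<subseteq> {i. \<pi> i \<noteq> i} \<union> {c, d}"
    by (auto simp: transpose_def)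
  then have "finite {i. (\<pi> \<circ> transpose c d) i \<noteq> i}"
    using S_infinity_finite[OF assms(1)] by (meson finite.emptyI finite_UnI finite_insert finite_subset)
  ultimately show ?thesis unfolding S_infinity_def by blast
qed

lemma finite_inversions:
  assumes "\<pi> \<in> S_infinity"
  shows "finite (inversions \<pi>)"
proof -
  obtain N where N: "\<forall>i\<in>{i. \<pi> i \<noteq> i}. i \<le> N"
    using S_infinity_finite[OF assms] Max_ge by blast
  then have fixed: "\<pi> i = i" if "N < i" for i
    using that by force
  have "inversions \<pi> \<subseteq> {1..N} \<times> {1..N}"
  proof
    fix p assume "p \<in> inversions \<pi>"
    then obtain i j where p: "p = (i, j)" "1 \<le> i" "i < j" "\<pi> j < \<pi> i"
      by (auto simp: inversions_def)
    have "j \<le> N"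
    proof (rule ccontr)
      assume "\<not> j \<le> N"
      then have "\<pi> j = j" "N < \<pi> i" using fixed p by auto
      then have "\<pi> (\<pi> i) = \<pi> i" using fixed by blast
      then have "\<pi> i = i" using S_infinity_inj[OF assms] by blast
      then show False using p \<open>\<pi> j = j\<close> by simp
    qed
    then show "p \<in> {1..N} \<times> {1..N}" using p by auto
  qed
  then show ?thesis by (meson finite_SigmaI finite_atLeastAtMost_int finite_subset)
qed

text \<open>Multiplying by a transposition that creates the inversion \<open>(c, d)\<close>: conjugation, where it
  keeps the order of a pair, embeds the old inversions into the new ones and misses \<open>(c, d)\<close>.
  It misses nothing else unless some value strictly between positions \<open>c\<close> and \<open>d\<close> lies strictly
  between the two exchanged values.\<close>

lemma perm_length_comp_transpose:
  assumes w: "w \<in> S_infinity" and c: "1 \<le> c" "c < d" and less: "w c < w d"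
  shows "perm_length w < perm_length (w \<circ> transpose c d)" (is ?less)
    and "\<nexists>f. c < f \<and> f < d \<and> w c < w f \<and> w f < w d \<Longrightarrow>
      perm_length (w \<circ> transpose c d) = perm_length w + 1" (is "_ \<Longrightarrow> ?eq")
    and "c < f \<Longrightarrow> f < d \<Longrightarrow> w c < w f \<Longrightarrow> w f < w d \<Longrightarrow>
      perm_length w + 1 < perm_length (w \<circ> transpose c d)" (is "_ \<Longrightarrow> _ \<Longrightarrow> _ \<Longrightarrow> _ \<Longrightarrow> ?gt")
proof -
  let ?t = "transpose c d"
  let ?w = "w \<circ> ?t"
  \<comment> \<open>The exchanged pair \<open>(t i, t j)\<close> is out of order only for pairs involving \<open>c\<close> or \<open>d\<close> with the
    other position in between, or for \<open>(c, d)\<close> itself; such pairs are kept.\<close>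
  define \<psi> where "\<psi> = (\<lambda>(i, j). if ?t i < ?t j then (?t i, ?t j) else (i, j))"
  have fin: "finite (inversions w)" "finite (inversions ?w)"
    using finite_inversions w S_infinity_comp_transpose c by auto
  have inj: "inj_on \<psi> (inversions w)"
  proof (rule inj_onI)
    fix p q assume "p \<in> inversions w" "q \<in> inversions w" "\<psi> p = \<psi> q"
    then show "p = q"
      unfolding \<psi>_def inversions_def
      by (auto split: if_splits dest: injD[OF inj_on_transpose[of _ _ UNIV]])
  qed
  have t1: "1 \<le> ?t i" if "1 \<le> i" for i
    using that c by (auto simp: transpose_def)
  have sub: "\<psi> ` inversions w \<subseteq> inversions ?w - {(c, d)}"
  proof (rule image_subsetI)
    fix p assume "p \<in> inversions w"
    then obtain i j where p: "p = (i, j)" "1 \<le> i" "i < j" "w j < w i"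
      by (auto simp: inversions_def)
    show "\<psi> p \<in> inversions ?w - {(c, d)}"
    proof (cases "?t i < ?t j")
      case True
      then have "(?t i, ?t j) \<noteq> (c, d)"
        using p c by (auto simp: transpose_def split: if_splits)
      then show ?thesis
        using True p t1 by (auto simp: \<psi>_def inversions_def)
    next
      case False
      then have "i = c \<and> c < j \<and> j < d \<or> j = d \<and> c < i \<and> i < d \<or> i = c \<and> j = d"
        using p(3) c(2) by (auto simp: transpose_def split: if_splits)
      then show ?thesis
        using False p c less by (auto simp: \<psi>_def inversions_def transpose_def)
    qed
  qed
  have cd: "(c, d) \<in> inversions ?w"
    using c less by (simp add: inversions_def)
  have card_img: "card (\<psi> ` inversions w) = perm_length w"
    by (simp add: perm_length_def card_image[OF inj])
  have card_rest: "card (inversions ?w - {(c, d)}) + 1 = perm_length ?w"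
    using cd fin(2) by (simp add: perm_length_def)
      (metis One_nat_def Suc_pred card_gt_0_iff empty_iff)
  show ?less
    using card_mono[OF _ sub] fin(2) card_img card_rest by simp
  show ?eq if none: "\<nexists>f. c < f \<and> f < d \<and> w c < w f \<and> w f < w d"
  proof -
    have "inversions ?w - {(c, d)} \<subseteq> \<psi> ` inversions w"
    proof
      fix p assume "p \<in> inversions ?w - {(c, d)}"
      then obtain i j where p: "p = (i, j)" "1 \<le> i" "i < j" "?w j < ?w i" "(i, j) \<noteq> (c, d)"
        by (auto simp: inversions_def)
      show "p \<in> \<psi> ` inversions w"
      proof (cases "?t i < ?t j")
        case True
        then have "(?t i, ?t j) \<in> inversions w" "\<psi> (?t i, ?t j) = p"
          using p t1 by (auto simp: \<psi>_def inversions_def)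
        then show ?thesis by (metis image_eqI)
      next
        case False
        then have ij: "i = c \<and> c < j \<and> j < d \<or> j = d \<and> c < i \<and> i < d"
          using p(3,5) c(2) by (auto simp: transpose_def split: if_splits)
        have "w j < w i"
        proof -
          from ij consider "i = c" "c < j" "j < d" | "j = d" "c < i" "i < d" by blast
          then show ?thesis
          proof cases
            case 1
            then have "w j < w d" "w j \<noteq> w c" using p(4) S_infinity_inj[OF w] by simp_all
            then show ?thesis using none 1 by force
          next
            case 2
            then have "w c < w i" "w i \<noteq> w d" using p(4) S_infinity_inj[OF w] by simp_all
            then show ?thesis using none 2 by force
          qed
        qed
        then have "(i, j) \<in> inversions w" "\<psi> (i, j) = p"
          using p False by (auto simp: \<psi>_def inversions_def)
        then show ?thesis by (metis image_eqI)
      qed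
    qed
    then have "\<psi> ` inversions w = inversions ?w - {(c, d)}" using sub by blast
    then show ?eq using card_img card_rest by simp
  qed
  show ?gt if f: "c < f" "f < d" "w c < w f" "w f < w d"
  proof -
    have "(c, f) \<notin> \<psi> ` inversions w"
    proof
      assume "(c, f) \<in> \<psi> ` inversions w"
      then obtain i j where ij: "(i, j) \<in> inversions w" "\<psi> (i, j) = (c, f)" by auto
      show False
      proof (cases "?t i < ?t j")
        case True
        then have "?t i = c" "?t j = f" using ij by (auto simp: \<psi>_def)
        then have "i = d" "j = f" using f by (auto simp: transpose_def split: if_splits)
        then show False using ij f by (simp add: inversions_def)
      next
        case False
        then show False using ij f by (simp add: \<psi>_def inversions_def)
      qed
    qed
    moreover have "(c, f) \<in> inversions ?w - {(c, d)}"
      using f c by (simp add: inversions_def)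
    ultimately have "\<psi> ` inversions w \<subset> inversions ?w - {(c, d)}" using sub by blast
    then have "card (\<psi> ` inversions w) < card (inversions ?w - {(c, d)})"
      using fin(2) by (intro psubset_card_mono) auto
    then show ?gt using card_img card_rest by simp
  qed
qed

lemma perm_length_id: "perm_length id = 0"
proof -
  have "inversions id = {}" by (auto simp: inversions_def)
  then show ?thesis by (simp add: perm_length_def)
qed

lemma inversions_nonempty:
  assumes "\<pi> \<in> S_infinity" "\<pi> \<noteq> id"
  shows "inversions \<pi> \<noteq> {}"
proof -
  let ?M = "{i. \<pi> i \<noteq> i}"
  have M: "finite ?M" "?M \<noteq> {}"
    using assms S_infinity_finite by (auto simp: fun_eq_iff)
  define i where "i = Min ?M"
  have i: "\<pi> i \<noteq> i" using Min_in[OF M] by (simp add: i_def)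
  have fixed: "\<pi> k = k" if "k < i" for k
    using that Min_le[OF M(1), of k] unfolding i_def by force
  have perm: "\<pi> permutes {1..}" using assms S_infinity_permutes by blast
  have "1 \<le> i" using i permutes_not_in[OF perm] by (metis atLeast_iff)
  obtain j where j: "\<pi> j = i" using permutes_surj[OF perm] by (metis surjD)
  have "i < j"
    using j i fixed[of j] by (metis linorder_neqE_linordered_idom)
  moreover have "i < \<pi> i"
  proof (rule ccontr)
    assume "\<not> i < \<pi> i"
    then have "\<pi> (\<pi> i) = \<pi> i" using i fixed by simp
    then show False using i S_infinity_inj[OF assms(1)] by blast
  qed
  ultimately have "(i, j) \<in> inversions \<pi>"
    using j \<open>1 \<le> i\<close> by (simp add: inversions_def)
  then show ?thesis by blast
qed

section \<open>The lex largest inversion\<close>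

locale nontrivial_permutation =
  fixes \<pi> :: "int \<Rightarrow> int"
  assumes in_S_infinity: "\<pi> \<in> S_infinity" and nontrivial: "\<pi> \<noteq> id"
begin

abbreviation r :: int where "r \<equiv> lex_r \<pi>"
abbreviation s :: int where "s \<equiv> lex_s \<pi>"
abbreviation \<nu> :: "int \<Rightarrow> int" where "\<nu> \<equiv> nu \<pi>"

lemma finite_inversion_parts: "finite {i. \<exists>j. (i, j) \<in> inversions \<pi>}" "finite {j. (i, j) \<in> inversions \<pi>}"
proof -
  have "{i. \<exists>j. (i, j) \<in> inversions \<pi>} = fst ` inversions \<pi>" by force
  then show "finite {i. \<exists>j. (i, j) \<in> inversions \<pi>}"
    using finite_inversions[OF in_S_infinity] by simp
  have "{j. (i, j) \<in> inversions \<pi>} \<subseteq> snd ` inversions \<pi>" by force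
  then show "finite {j. (i, j) \<in> inversions \<pi>}"
    using finite_inversions[OF in_S_infinity] finite_subset by blast
qed

lemma lex_largest_inversion: "(r, s) \<in> inversions \<pi>"
  and lex_r_greatest: "(i, j) \<in> inversions \<pi> \<Longrightarrow> i \<le> r"
  and lex_s_greatest: "(r, j) \<in> inversions \<pi> \<Longrightarrow> j \<le> s"
proof -
  have "{i. \<exists>j. (i, j) \<in> inversions \<pi>} \<noteq> {}"
    using inversions_nonempty[OF in_S_infinity nontrivial] by auto
  then have "\<exists>j. (r, j) \<in> inversions \<pi>"
    using Max_in[OF finite_inversion_parts(1)] unfolding lex_r_def by blast
  then show "(r, s) \<in> inversions \<pi>"
    using Max_in[OF finite_inversion_parts(2), of r] unfolding lex_s_def by blast
  show "(i, j) \<in> inversions \<pi> \<Longrightarrow> i \<le> r"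
    unfolding lex_r_def using Max_ge[OF finite_inversion_parts(1)] by blast
  show "(r, j) \<in> inversions \<pi> \<Longrightarrow> j \<le> s"
    unfolding lex_s_def[of \<pi>] using Max_ge[OF finite_inversion_parts(2)] by blast
qed

lemma r_pos: "1 \<le> r" and r_less_s: "r < s" and value_descent: "\<pi> s < \<pi> r"
  using lex_largest_inversion by (simp_all add: inversions_def)

lemma increasing_above_r: "r < i \<Longrightarrow> i < j \<Longrightarrow> \<pi> i < \<pi> j"
  using lex_r_greatest[of i j] r_pos S_infinity_inj[OF in_S_infinity, of i j]
  by (force simp: inversions_def neq_iff)

lemma value_above_s: "s < j \<Longrightarrow> \<pi> r < \<pi> j"
  using lex_s_greatest[of j] r_pos r_less_s S_infinity_inj[OF in_S_infinity, of r j]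
  by (force simp: inversions_def neq_iff)

lemma nu_values [simp]: "\<nu> r = \<pi> s" "\<nu> s = \<pi> r"
  and nu_other: "i \<noteq> r \<Longrightarrow> i \<noteq> s \<Longrightarrow> \<nu> i = \<pi> i"
  by (simp_all add: nu_def)

lemma nu_in_S_infinity: "\<nu> \<in> S_infinity"
  unfolding nu_def using in_S_infinity r_pos r_less_s by (intro S_infinity_comp_transpose) auto

lemma nu_comp_transpose: "\<nu> \<circ> transpose r s = \<pi>"
  by (simp add: nu_def comp_assoc)

lemma nu_increasing_above_r: "r < i \<Longrightarrow> i < j \<Longrightarrow> \<nu> i < \<nu> j"
proof -
  assume ij: "r < i" "i < j"
  consider "i = s" | "j = s" | "i \<noteq> s" "j \<noteq> s" by blast
  then show ?thesis
  proof cases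
    case 1
    then show ?thesis using ij value_above_s[of j] by (simp add: nu_other)
  next
    case 2
    then show ?thesis using ij increasing_above_r[of i s] value_descent by (simp add: nu_other)
  next
    case 3
    then show ?thesis using ij increasing_above_r[of i j] by (simp add: nu_other)
  qed
qed

lemma perm_length_nu: "perm_length \<pi> = perm_length \<nu> + 1"
proof -
  have "\<nexists>f. r < f \<and> f < s \<and> \<nu> r < \<nu> f \<and> \<nu> f < \<nu> s"
    using increasing_above_r[of _ s] by (fastforce simp: nu_other)
  then show ?thesis
    using perm_length_comp_transpose(2)[OF nu_in_S_infinity r_pos r_less_s] value_descent
    by (simp add: nu_comp_transpose)
qed

text \<open>Why \<open>(r, s)\<close> is chosen lex largest: among the transpositions \<open>t\<^sub>r\<^sub>q\<close> with \<open>q > r\<close>, only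
  \<open>t\<^sub>r\<^sub>s\<close> increases the length of \<open>\<nu>\<close> by exactly one.\<close>

lemma cover_above_r:
  assumes "r < q" "\<nu> r < \<nu> q" "perm_length (\<nu> \<circ> transpose r q) = perm_length \<nu> + 1"
  shows "q = s"
proof (rule ccontr)
  assume "q \<noteq> s"
  then consider "q < s" | "s < q" by linarith
  then show False
  proof cases
    case 1
    then show False using increasing_above_r[of q s] assms(1,2) by (simp add: nu_other)
  next
    case 2
    then have "\<nu> s < \<nu> q" using nu_increasing_above_r[of s q] r_less_s by simp
    then show False
      using perm_length_comp_transpose(3)[OF nu_in_S_infinity r_pos assms(1,2), of s]
        2 r_less_s value_descent assms(3) by simp
  qed
qed

lemma admissible_r: "admissible \<pi> r"
  by (simp add: admissible_def)

lemma admissible_bounds: "admissible \<pi> q \<Longrightarrow> 1 \<le> q \<and> q \<le> r"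
  using r_pos by (auto simp: admissible_def)

lemma successor_in_S_infinity: "admissible \<pi> q \<Longrightarrow> \<nu> \<circ> transpose q r \<in> S_infinity"
  using admissible_bounds[of q] r_pos by (intro S_infinity_comp_transpose nu_in_S_infinity) auto

lemma admissible_less:
  assumes "admissible \<pi> q" "q < r"
  shows "perm_length (\<nu> \<circ> transpose q r) = perm_length \<pi>" "\<nu> q < \<nu> r"
proof -
  show len: "perm_length (\<nu> \<circ> transpose q r) = perm_length \<pi>"
    using assms by (simp add: admissible_def)
  show "\<nu> q < \<nu> r"
  proof (rule ccontr)
    let ?w = "\<nu> \<circ> transpose q r"
    assume "\<not> ?thesis"
    then have "?w q < ?w r"
      using assms(2) S_infinity_inj[OF nu_in_S_infinity, of q r] by simp
    then have "perm_length ?w < perm_length (?w \<circ> transpose q r)"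
      using perm_length_comp_transpose(1)[OF successor_in_S_infinity] assms admissible_bounds by blast
    then show False using len perm_length_nu by (simp add: comp_assoc)
  qed
qed

lemma transition_index_eq:
  assumes "admissible \<pi> q"
  shows "transition_index \<pi> (\<nu> \<circ> transpose q r) = q"
  unfolding transition_index_def
proof (rule the_equality)
  show "admissible \<pi> q \<and> \<nu> \<circ> transpose q r = \<nu> \<circ> transpose q r" using assms by simp
  show "q' = q" if "admissible \<pi> q' \<and> \<nu> \<circ> transpose q r = \<nu> \<circ> transpose q' r" for q'
  proof -
    have "\<nu> (transpose q r r) = \<nu> (transpose q' r r)" using that by (metis comp_apply)
    then show ?thesis using S_infinity_inj[OF nu_in_S_infinity] by simp
  qed
qed

text \<open>The recursion of the two algorithms is well founded: a transition to \<open>q = r\<close> decreases the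
  length, and one to \<open>q < r\<close> keeps the length but lowers the value in position \<open>r\<close>, so that the lex
  largest inversion decreases.\<close>

definition (in -) transition_order :: "((int \<Rightarrow> int) \<times> (int \<Rightarrow> int)) set" where
  "transition_order = inv_image (less_than <*lex*> less_than <*lex*> less_than)
     (\<lambda>\<tau>. (perm_length \<tau>, nat (lex_r \<tau>), nat (lex_s \<tau>)))"

lemma (in -) wf_transition_order: "wf transition_order"
  unfolding transition_order_def by (intro wf_inv_image wf_lex_prod wf_less_than)

lemma successor_less:
  assumes "admissible \<pi> q"
  shows "(\<nu> \<circ> transpose q r, \<pi>) \<in> transition_order"
proof (cases "q = r")
  case True
  then show ?thesis using perm_length_nu by (simp add: transition_order_def)
next
  case False
  let ?w = "\<nu> \<circ> transpose q r"
  have q: "q < r" "1 \<le> q" using False admissible_bounds[OF assms] by auto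
  have len: "perm_length ?w = perm_length \<pi>" and less: "\<nu> q < \<nu> r"
    using admissible_less[OF assms q(1)] by auto
  have "?w \<noteq> id"
  proof
    assume "?w = id"
    then have "perm_length ?w = 0" using perm_length_id by simp
    then show False using len perm_length_nu by simp
  qed
  then interpret w: nontrivial_permutation ?w
    using successor_in_S_infinity[OF assms] by unfold_locales
  have above: "?w i = \<nu> i" if "r < i" for i
    using that q by (simp add: transpose_def)
  have "w.r \<le> r"
    using nu_increasing_above_r[of w.r w.s] above[of w.r] above[of w.s] w.value_descent w.r_less_s
    by (cases "r < w.r") auto
  moreover have "w.s < s" if "w.r = r"
  proof -
    have "?w w.s < ?w r" using w.value_descent that by simp
    then have "\<nu> w.s < \<nu> r" using above[of w.s] w.r_less_s that less by auto
    then have "\<nu> w.s < \<nu> s" using value_descent by simp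
    then show ?thesis
      using nu_increasing_above_r[of s w.s] r_less_s by (cases w.s s rule: linorder_cases) auto
  qed
  ultimately show ?thesis
    using len w.r_pos r_pos w.r_less_s r_less_s unfolding transition_order_def by auto
qed

end

section \<open>The bounded transition is a bijection\<close>

lemma crossing_col_eq:
  assumes "reduced a" "i < length a" "crossings a ! i = {x, y}"
  shows "crossing_col a x y = Suc i"
  unfolding crossing_col_def
proof (rule the_equality)
  show "1 \<le> Suc i \<and> Suc i \<le> length a \<and> crossing a (Suc i) = {x, y}"
    using assms by (simp add: crossing_eq_nth_crossings)
  show "t = Suc i" if t: "1 \<le> t \<and> t \<le> length a \<and> crossing a t = {x, y}" for t
  proof -
    obtain k where k: "t = Suc k" "k < length a" using t by (cases t) auto
    then have "crossings a ! k = crossings a ! i"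
      using t assms(3) crossing_eq_nth_crossings[OF k(2)] by simp
    then show ?thesis
      using k assms(1,2) nth_eq_iff_index_eq[of "crossings a" k i] by (simp add: reduced_iff_distinct)
  qed
qed

lemma insert_col_delete_col:
  "i < length a \<Longrightarrow> insert_col (Suc i) (a ! i) (delete_col (Suc i) a) = a"
  by (simp add: insert_col_def delete_col_Suc word_at_column[symmetric])

lemma delete_col_insert_col:
  "k \<le> length a \<Longrightarrow> delete_col (Suc k) (insert_col (Suc k) x a) = a"
  by (simp add: insert_col_def delete_col_Suc)

lemma nth_insert_col: "k \<le> length a \<Longrightarrow> insert_col (Suc k) x a ! k = x"
  by (simp add: insert_col_def nth_append)

lemma bounded_wordI:
  "length b = length a \<Longrightarrow> (\<And>k. k < length a \<Longrightarrow> 1 \<le> b ! k \<and> b ! k \<le> a ! k) \<Longrightarrow> bounded_word a b"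
  by (simp add: bounded_word_def)

lemma bounded_word_iff: "bounded_word a b \<longleftrightarrow> list_all2 (\<lambda>x y. 1 \<le> y \<and> y \<le> x) a b"
  by (auto simp: bounded_word_def list_all2_conv_all_nth)

lemma bump_state_bounded_delete:
  assumes "bump_state \<nu> r \<epsilon> i a b"
  shows "bounded_word (delete_col (Suc i) a) (delete_col (Suc i) b)"
proof -
  have i: "i < length a" "length b = length a"
    and bnd: "\<And>k. k < length a \<Longrightarrow> k \<noteq> i \<Longrightarrow> 1 \<le> b ! k \<and> b ! k \<le> a ! k"
    using assms by (auto simp: bump_state_def)
  have "list_all2 (\<lambda>x y. 1 \<le> y \<and> y \<le> x) (take i a) (take i b)"
    and "list_all2 (\<lambda>x y. 1 \<le> y \<and> y \<le> x) (drop (Suc i) a) (drop (Suc i) b)"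
    using i bnd unfolding list_all2_conv_all_nth by auto
  then show ?thesis
    by (simp add: bounded_word_iff delete_col_Suc list_all2_appendI)
qed

lemma bump_state_bounded:
  assumes "bump_state \<nu> r \<epsilon> i a b" "b ! i \<noteq> 0"
  shows "bounded_word a b"
proof (rule bounded_wordI)
  show "length b = length a" using assms by (simp add: bump_state_def)
  show "1 \<le> b ! k \<and> b ! k \<le> a ! k" if "k < length a" for k
    using assms that unfolding bump_state_def by (cases "k = i") (auto split: if_splits)
qed

lemma bounded_pair_length: "(a, b) \<in> bounded_pairs \<pi> \<Longrightarrow> length a = perm_length \<pi> \<and> length b = perm_length \<pi>"
  by (auto simp: bounded_pairs_def reduced_words_def reduced_def bounded_word_def)

context nontrivial_permutation
begin

text \<open>Runs start at the column of an inversion \<open>(x, y)\<close> whose removal lowers the length by one: of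
  \<open>(r, s)\<close> for downward runs, of \<open>(q, r)\<close> for upward ones.\<close>

lemma bounded_pair_at_inversion:
  assumes ab: "(a, b) \<in> bounded_pairs \<tau>" and inv: "x < y" "\<tau> y < \<tau> x"
    and len: "perm_length \<tau> = perm_length (\<tau> \<circ> transpose x y) + 1"
  obtains i where "i < length a" "crossing_col a x y = Suc i"
    "bump_state (\<tau> \<circ> transpose x y) x (- 1) i a b" "bump_state (\<tau> \<circ> transpose x y) y 1 i a b"
proof -
  have red: "reduced a" and \<tau>: "word_perm a = \<tau>" and bw: "bounded_word a b"
    using ab by (auto simp: bounded_pairs_def reduced_words_def)
  have "{x, y} \<in> set (crossings a)"
    using set_crossings_reduced[OF red] inv \<tau> by (simp add: pair_in_crossed)
  then obtain i where i: "i < length a" "crossings a ! i = {x, y}"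
    by (auto simp: in_set_conv_nth)
  have wp: "word_perm (delete_col (Suc i) a) = \<tau> \<circ> transpose x y"
    using word_perm_delete_col'[OF i] \<tau> by simp
  have "length (delete_col (Suc i) a) = perm_length (\<tau> \<circ> transpose x y)"
    using len red \<tau> i by (simp add: reduced_def)
  moreover have "\<forall>z\<in>set (delete_col (Suc i) a). 1 \<le> z"
    using red set_delete_col by (auto simp: reduced_def)
  ultimately have redd: "reduced (delete_col (Suc i) a)"
    using wp by (simp add: reduced_def)
  have "lower_wire a i < upper_wire a i" "{lower_wire a i, upper_wire a i} = {x, y}"
    using reduced_lower_less_upper[OF red i(1)] nth_crossings[OF i(1)] i(2) by auto
  then have "lower_wire a i = x" "upper_wire a i = y"
    using inv(1) by (auto simp: doubleton_eq_iff)
  then have "bump_state (\<tau> \<circ> transpose x y) x (- 1) i a b"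
    "bump_state (\<tau> \<circ> transpose x y) y 1 i a b"
    using i(1) redd wp bw unfolding bump_state_def bounded_word_def by auto
  then show ?thesis
    using that crossing_col_eq[OF red i] i(1) by blast
qed

lemma downward_start:
  assumes "(a, b) \<in> bounded_pairs \<pi>"
  obtains i where "i < length a" "crossing_col a r s = Suc i" "bump_state \<nu> r (- 1) i a b"
  using bounded_pair_at_inversion[OF assms r_less_s value_descent] perm_length_nu
  by (metis nu_def)

text \<open>A stopped upward run ends at a crossing of \<open>r\<close> with a larger label; that label is \<open>s\<close> by the choice
  of \<open>(r, s)\<close>, so the run ends in a word for \<open>\<pi>\<close>.\<close>

lemma upward_end:
  assumes st: "bump_state \<nu> r (- 1) i a b" and red: "reduced a"
  shows "(a, b) \<in> bounded_pairs \<pi>" "crossing_col a r s = Suc i"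
proof -
  define q where "q = upper_wire a i"
  have i: "i < length a" and low: "lower_wire a i = r"
    and \<nu>: "reduced (delete_col (Suc i) a)" "word_perm (delete_col (Suc i) a) = \<nu>"
    using st by (auto simp: bump_state_def)
  have rq: "r < q"
    using reduced_lower_less_upper[OF red i] low by (simp add: q_def)
  have wp: "word_perm a = \<nu> \<circ> transpose r q"
    using word_perm_delete_col[OF i] low \<nu> by (simp add: q_def)
  have cr: "crossings a ! i = {r, q}"
    using nth_crossings[OF i] low by (simp add: q_def)
  then have "{r, q} \<in> crossed (word_perm a)"
    using set_crossings_reduced[OF red] i by (metis length_crossings nth_mem)
  then have "\<nu> r < \<nu> q"
    using rq unfolding wp pair_in_crossed by simp
  moreover have "perm_length (\<nu> \<circ> transpose r q) = perm_length \<nu> + 1"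
    using red \<nu> i unfolding reduced_def wp by simp linarith
  ultimately have "q = s" using cover_above_r[OF rq] by blast
  then show "crossing_col a r s = Suc i" using crossing_col_eq[OF red i] cr by simp
  have "word_perm a = \<pi>" using wp \<open>q = s\<close> nu_comp_transpose by simp
  moreover have "bounded_word a b"
    using bump_state_bounded[OF st] st unfolding bump_state_def by (auto split: if_splits)
  ultimately show "(a, b) \<in> bounded_pairs \<pi>"
    using red by (simp add: bounded_pairs_def reduced_words_def)
qed

lemma downward_end_deleted:
  assumes "bump_state \<nu> r 1 j a b"
  shows "(delete_col (Suc j) a, delete_col (Suc j) b) \<in> bounded_pairs \<nu>"
  using assms bump_state_bounded_delete[OF assms]
  by (simp add: bounded_pairs_def reduced_words_def bump_state_def)

text \<open>In a reduced word the lower of two crossing wires, seen from the right, has the smaller label;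
  hence \<open>q < r\<close>.\<close>

lemma downward_end_bumped:
  assumes st: "bump_state \<nu> r 1 j a b" and "b ! j \<noteq> 0" and red: "reduced a"
  obtains q where "admissible \<pi> q" "q < r" "(a, b) \<in> bounded_pairs (\<nu> \<circ> transpose q r)"
    "crossing_col a q r = Suc j"
proof -
  define q where "q = lower_wire a j"
  have j: "j < length a" and up: "upper_wire a j = r"
    and \<nu>: "reduced (delete_col (Suc j) a)" "word_perm (delete_col (Suc j) a) = \<nu>"
    using st by (auto simp: bump_state_def)
  have qr: "q < r"
    using reduced_lower_less_upper[OF red j] up by (simp add: q_def)
  have "word_perm (rev (drop (Suc j) a)) permutes {1..}"
    using red by (intro word_perm_permutes) (auto simp: reduced_def dest: in_set_dropD)
  moreover have "1 \<le> a ! j" using red j by (simp add: reduced_def)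
  ultimately have "1 \<le> q"
    unfolding q_def column_label_def by (metis atLeast_iff permutes_in_image)
  have wp: "word_perm a = \<nu> \<circ> transpose q r"
    using word_perm_delete_col[OF j] up \<nu> by (simp add: q_def)
  have cr: "crossings a ! j = {q, r}"
    using nth_crossings[OF j] up by (simp add: q_def)
  have "perm_length (\<nu> \<circ> transpose q r) = perm_length \<pi>"
    using red \<nu> j perm_length_nu unfolding reduced_def wp by simp linarith
  then have "admissible \<pi> q"
    using \<open>1 \<le> q\<close> qr by (simp add: admissible_def)
  moreover have "(a, b) \<in> bounded_pairs (\<nu> \<circ> transpose q r)"
    using bump_state_bounded[OF st \<open>b ! j \<noteq> 0\<close>] red wp
    by (simp add: bounded_pairs_def reduced_words_def)
  ultimately show ?thesis using that qr crossing_col_eq[OF red j cr] by blast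
qed

lemma upward_start_bumped:
  assumes q: "admissible \<pi> q" "q < r" and ab: "(a, b) \<in> bounded_pairs (\<nu> \<circ> transpose q r)"
  obtains j where "j < length a" "crossing_col a q r = Suc j" "bump_state \<nu> r 1 j a b" "b ! j \<noteq> 0"
proof -
  let ?\<tau> = "\<nu> \<circ> transpose q r"
  have cancel: "?\<tau> \<circ> transpose q r = \<nu>" by (simp add: comp_assoc)
  have "?\<tau> r < ?\<tau> q" "perm_length ?\<tau> = perm_length (?\<tau> \<circ> transpose q r) + 1"
    using admissible_less[OF q] perm_length_nu unfolding cancel by simp_all
  from bounded_pair_at_inversion[OF ab q(2) this] obtain j where j: "j < length a"
    "crossing_col a q r = Suc j" "bump_state \<nu> r 1 j a b" unfolding cancel by blast
  moreover have "b ! j \<noteq> 0"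
    using ab j(1) by (auto simp: bounded_pairs_def bounded_word_def)
  ultimately show ?thesis using that by blast
qed

text \<open>The letter inserted by the inverse bounded transition is chosen such that \<open>r\<close> is the upper wire of
  the new crossing, which is what an upward run requires.\<close>

lemma upward_start_inserted:
  assumes ef: "(e, f) \<in> bounded_pairs \<nu>" and k: "1 \<le> k" "k \<le> perm_length \<pi>"
  defines "x \<equiv> inv (word_perm (rev (drop (k - 1) e))) r - 1"
  shows "bump_state \<nu> r 1 (k - 1) (insert_col k x e) (insert_col k 0 f)"
proof -
  obtain j where j: "k = Suc j" using k by (cases k) auto
  have red: "reduced e" "word_perm e = \<nu>" and bw: "bounded_word e f"
    using ef by (auto simp: bounded_pairs_def reduced_words_def)
  have len: "length e = perm_length \<nu>" "length f = length e" "j \<le> length e"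
    using bounded_pair_length[OF ef] perm_length_nu k j by auto
  have x: "x = word_perm (drop j e) r - 1"
    using inv_word_perm[of "rev (drop j e)"] by (simp add: x_def j)
  have "word_perm (drop j e) permutes {1..}"
    using red by (intro word_perm_permutes) (auto simp: reduced_def dest: in_set_dropD)
  then have "0 \<le> x"
    using x r_pos by (metis atLeast_iff diff_ge_0_iff_ge permutes_in_image)
  have "upper_wire (insert_col k x e) j = r"
    using x len j by (simp add: column_label_def nth_insert_col) (simp add: insert_col_def)
  moreover have "(if m = j then 0 else 1) \<le> insert_col k 0 f ! m \<and>
      insert_col k 0 f ! m \<le> insert_col k x e ! m" if "m < length (insert_col k x e)" for m
  proof -
    have "m < Suc (length e)" using that len j by (simp add: insert_col_def)
    then have "m < j \<or> m = j \<or> (\<exists>n. m = Suc n \<and> j \<le> n \<and> n < length e)" by presburger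
    then consider "m < j" | "m = j" | n where "m = Suc n" "j \<le> n" "n < length e" by blast
    then show ?thesis
    proof cases
      case 3
      then show ?thesis
        using bw len j unfolding bounded_word_def
        by (auto simp: insert_col_def nth_append nth_Cons Suc_diff_le)
    qed (use bw len j \<open>0 \<le> x\<close> in
        \<open>auto simp: insert_col_def nth_append bounded_word_def\<close>)
  qed
  ultimately show ?thesis
    using red len j unfolding bump_state_def
    by (simp add: delete_col_insert_col) (simp add: insert_col_def)
qed

lemma finite_support_nu: "finite {y. \<nu> y \<noteq> y}"
  using S_infinity_finite[OF nu_in_S_infinity] .

text \<open>The two runs used by all four transition maps, with an invariant of the caller's choice.\<close>

lemma downward_run:
  fixes J :: "int \<Rightarrow> nat \<Rightarrow> int list \<Rightarrow> int list \<Rightarrow> bool"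
  assumes J_push: "\<And>i a b. J (- 1) i a b \<Longrightarrow> bump_state \<nu> r (- 1) i a b \<Longrightarrow>
        J 1 i (push (- 1) (Suc i) a) (push (- 1) (Suc i) b)"
    and J_defect: "\<And>i j a b. J 1 i a b \<Longrightarrow> bump_state \<nu> r 1 i a b \<Longrightarrow> b ! i \<noteq> 0 \<Longrightarrow>
        \<forall>k. k \<noteq> i \<longrightarrow> nearly_reduced a (Suc k) \<longrightarrow> k = j \<Longrightarrow> J (- 1) j a b"
    and ab: "(a, b) \<in> bounded_pairs \<pi>" and J: "\<And>i. J (- 1) i a b"
  obtains j a' b' x t where "bump_state \<nu> r 1 j a' b'" "J 1 j a' b'" "b' ! j = 0 \<or> reduced a'"
    "length a' = length a"
    "bounded_bump (- 1) (crossing_col a r s) a b = bump_check (- 1) (Suc j) a' b'"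
    "bounded_bump 1 (Suc j) a' b' = Some (a, b, x, t, Bumped)"
proof -
  obtain i where i: "i < length a" "crossing_col a r s = Suc i" "bump_state \<nu> r (- 1) i a b"
    using downward_start[OF ab] by blast
  have "b ! i \<noteq> 0" "reduced a"
    using ab i(1) by (auto simp: bounded_pairs_def bounded_word_def reduced_words_def)
  then have stop: "bump_check 1 (Suc i) a b = Some (a, b, a ! i, Suc i, Bumped)"
    by (simp add: bump_check_def)
  have "\<exists>j a' b'. bump_state \<nu> r (- (- 1)) j a' b' \<and> J (- (- 1)) j a' b' \<and>
      (b' ! j = 0 \<or> reduced a') \<and> length a' = length a \<and>
      bounded_bump (- 1) (Suc i) a b = bump_check (- 1) (Suc j) a' b' \<and>
      bounded_bump (- (- 1)) (Suc j) a' b' = bump_check (- (- 1)) (Suc i) a b"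
  proof (rule bounded_bump_reversible[OF finite_support_nu])
    show "J (- (- 1)) i (push (- 1) (Suc i) a) (push (- 1) (Suc i) b)"
      if "J (- 1) i a b" "bump_state \<nu> r (- 1) i a b" for i a b
      using J_push[OF that] by simp
    show "J (- 1) j a b"
      if "J (- (- 1)) i a b" "bump_state \<nu> r (- (- 1)) i a b" "b ! i \<noteq> 0"
        "\<forall>k. k \<noteq> i \<longrightarrow> nearly_reduced a (Suc k) \<longrightarrow> k = j" for i j a b
      using J_defect[of i a b j] that by simp
  qed (use i(3) J in simp_all)
  then obtain j a' b' where run: "bump_state \<nu> r (- (- 1)) j a' b'" "J (- (- 1)) j a' b'"
    "b' ! j = 0 \<or> reduced a'" "length a' = length a"
    "bounded_bump (- 1) (Suc i) a b = bump_check (- 1) (Suc j) a' b'"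
    "bounded_bump (- (- 1)) (Suc j) a' b' = bump_check (- (- 1)) (Suc i) a b"
    by blast
  have "bump_state \<nu> r 1 j a' b'" "J 1 j a' b'"
    "bounded_bump 1 (Suc j) a' b' = Some (a, b, a ! i, Suc i, Bumped)"
    using run(1,2,6) stop by simp_all
  then show ?thesis using that run(3-5) i(2) by simp
qed

lemma upward_run:
  fixes J :: "int \<Rightarrow> nat \<Rightarrow> int list \<Rightarrow> int list \<Rightarrow> bool"
  assumes J_push: "\<And>i a b. J 1 i a b \<Longrightarrow> bump_state \<nu> r 1 i a b \<Longrightarrow>
        J (- 1) i (push 1 (Suc i) a) (push 1 (Suc i) b)"
    and J_defect: "\<And>i j a b. J (- 1) i a b \<Longrightarrow> bump_state \<nu> r (- 1) i a b \<Longrightarrow> b ! i \<noteq> 0 \<Longrightarrow>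
        \<forall>k. k \<noteq> i \<longrightarrow> nearly_reduced a (Suc k) \<longrightarrow> k = j \<Longrightarrow> J 1 j a b"
    and st: "bump_state \<nu> r 1 j a b" and J: "J 1 j a b"
  obtains i a' b' x t where "J (- 1) i a' b'" "(a', b') \<in> bounded_pairs \<pi>"
    "bounded_bump 1 (Suc j) a b = Some (a', b', x, t, Bumped)"
    "bounded_bump (- 1) (crossing_col a' r s) a' b' = bump_check (- 1) (Suc j) a b"
proof -
  have "\<exists>i a' b'. bump_state \<nu> r (- 1) i a' b' \<and> J (- 1) i a' b' \<and>
      (b' ! i = 0 \<or> reduced a') \<and> length a' = length a \<and>
      bounded_bump 1 (Suc j) a b = bump_check 1 (Suc i) a' b' \<and>
      bounded_bump (- 1) (Suc i) a' b' = bump_check (- 1) (Suc j) a b"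
    using J_push J_defect st J by (intro bounded_bump_reversible[OF finite_support_nu]) simp_all
  then obtain i a' b' where run: "bump_state \<nu> r (- 1) i a' b'" "J (- 1) i a' b'"
    "b' ! i = 0 \<or> reduced a'"
    "bounded_bump 1 (Suc j) a b = bump_check 1 (Suc i) a' b'"
    "bounded_bump (- 1) (Suc i) a' b' = bump_check (- 1) (Suc j) a b"
    by blast
  have b: "b' ! i \<noteq> 0"
    using run(1) unfolding bump_state_def by (auto split: if_splits)
  then have red: "reduced a'" using run(3) by simp
  have "bump_check 1 (Suc i) a' b' = Some (a', b', a' ! i, Suc i, Bumped)"
    using b red by (simp add: bump_check_def)
  then show ?thesis
    using that[OF run(2) upward_end(1)[OF run(1) red]] run(4,5) upward_end(2)[OF run(1) red] by simp
qed

lemma bump_check_stop_bumped: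
  "b ! j \<noteq> 0 \<Longrightarrow> reduced a \<Longrightarrow> bump_check \<epsilon> (Suc j) a b = Some (a, b, a ! j, Suc j, Bumped)"
  and bump_check_stop_deleted:
  "b ! j = 0 \<Longrightarrow> bump_check \<epsilon> (Suc j) a b =
     Some (delete_col (Suc j) a, delete_col (Suc j) b, a ! j, Suc j, Deleted)"
  by (simp_all add: bump_check_def)

lemma bounded_transition_inverse:
  assumes ab: "(a, b) \<in> bounded_pairs \<pi>"
  obtains q a' b' k where "admissible \<pi> q" "(a', b') \<in> bounded_pairs (\<nu> \<circ> transpose q r)"
    "if q = r then 1 \<le> k \<and> k \<le> perm_length \<pi> else k = 0"
    "bounded_transition \<pi> a b = Some ((a', b'), k)"
    "inv_bounded_transition \<pi> a' b' k = Some (a, b)"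
proof -
  obtain j a' b' x t where run: "bump_state \<nu> r 1 j a' b'" "b' ! j = 0 \<or> reduced a'"
    "length a' = length a"
    "bounded_bump (- 1) (crossing_col a r s) a b = bump_check (- 1) (Suc j) a' b'"
    "bounded_bump 1 (Suc j) a' b' = Some (a, b, x, t, Bumped)"
    using downward_run[where J = "\<lambda>_ _ _ _. True", OF _ _ ab] by metis
  have j: "j < length a'" "length b' = length a'" "upper_wire a' j = r"
    using run(1) by (auto simp: bump_state_def)
  show ?thesis
  proof (cases "b' ! j = 0")
    case True
    let ?e = "delete_col (Suc j) a'" and ?f = "delete_col (Suc j) b'"
    have ef: "(?e, ?f) \<in> bounded_pairs \<nu>" using downward_end_deleted[OF run(1)] .
    have len: "Suc j \<le> perm_length \<pi>" using j(1) run(3) bounded_pair_length[OF ab] by simp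
    have fwd: "bounded_transition \<pi> a b = Some ((?e, ?f), Suc j)"
      using True by (simp add: bounded_transition_def run(4) bump_check_stop_deleted)
    have wp: "word_perm ?e = \<nu>" using run(1) by (simp add: bump_state_def)
    have ti: "transition_index \<pi> \<nu> = r"
      using transition_index_eq[OF admissible_r] by simp
    have "drop j ?e = drop (Suc j) a'" using j(1) by (simp add: delete_col_Suc)
    then have "inv (word_perm (rev (drop j ?e))) r = a' ! j + 1"
      unfolding inv_word_perm j(3)[symmetric] column_label_def by simp
    then have ins: "insert_col (Suc j) (inv (word_perm (rev (drop j ?e))) r - 1) ?e = a'"
      "insert_col (Suc j) 0 ?f = b'"
      using insert_col_delete_col[of j a'] insert_col_delete_col[of j b'] j True by simp_all
    have "inv_bounded_transition \<pi> ?e ?f (Suc j) = Some (a, b)"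
      using ins run(5) by (simp add: inv_bounded_transition_def wp ti Let_def)
    then show ?thesis
      using that[OF admissible_r, of ?e ?f "Suc j"] ef fwd len by simp
  next
    case False
    then have red: "reduced a'" using run(2) by simp
    obtain q where q: "admissible \<pi> q" "q < r" "(a', b') \<in> bounded_pairs (\<nu> \<circ> transpose q r)"
      "crossing_col a' q r = Suc j"
      using downward_end_bumped[OF run(1) False red] by blast
    have fwd: "bounded_transition \<pi> a b = Some ((a', b'), 0)"
      using False red by (simp add: bounded_transition_def run(4) bump_check_stop_bumped)
    have "word_perm a' = \<nu> \<circ> transpose q r"
      using q(3) by (simp add: bounded_pairs_def reduced_words_def)
    then have "inv_bounded_transition \<pi> a' b' 0 = Some (a, b)"
      using q(2,4) run(5) transition_index_eq[OF q(1)]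
      by (simp add: inv_bounded_transition_def Let_def)
    then show ?thesis using that[OF q(1,3), of 0] fwd q(2) by simp
  qed
qed

lemma inv_bounded_transition_inverse:
  assumes q: "admissible \<pi> q" and ef: "(e, f) \<in> bounded_pairs (\<nu> \<circ> transpose q r)"
    and k: "if q = r then 1 \<le> k \<and> k \<le> perm_length \<pi> else k = 0"
  obtains a b where "(a, b) \<in> bounded_pairs \<pi>" "inv_bounded_transition \<pi> e f k = Some (a, b)"
    "bounded_transition \<pi> a b = Some ((e, f), k)"
proof -
  have wp: "word_perm e = \<nu> \<circ> transpose q r"
    using ef by (simp add: bounded_pairs_def reduced_words_def)
  have ti: "transition_index \<pi> (\<nu> \<circ> transpose q r) = q" using transition_index_eq[OF q] .
  show ?thesis
  proof (cases "q = r")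
    case True
    define g where "g = insert_col k (inv (word_perm (rev (drop (k - 1) e))) r - 1) e"
    define h where "h = insert_col k 0 f"
    obtain j where j: "k = Suc j" "j < perm_length \<pi>" using k True by (cases k) auto
    have st: "bump_state \<nu> r 1 j g h"
      using upward_start_inserted[of e f k] ef True k j by (simp add: g_def h_def)
    obtain a b x t where run: "(a, b) \<in> bounded_pairs \<pi>"
      "bounded_bump 1 (Suc j) g h = Some (a, b, x, t, Bumped)"
      "bounded_bump (- 1) (crossing_col a r s) a b = bump_check (- 1) (Suc j) g h"
      using upward_run[where J = "\<lambda>_ _ _ _. True", OF _ _ st] by metis
    have "j \<le> length e" "j \<le> length f"
      using bounded_pair_length[OF ef] True j perm_length_nu by auto
    then have "delete_col (Suc j) g = e" "delete_col (Suc j) h = f" "h ! j = 0"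
      by (simp_all add: g_def h_def j delete_col_insert_col nth_insert_col)
    then have "bounded_transition \<pi> a b = Some ((e, f), k)"
      using j(1) by (simp add: bounded_transition_def run(3) bump_check_stop_deleted)
    moreover have "inv_bounded_transition \<pi> e f k = Some (a, b)"
      using run(2) ti True unfolding inv_bounded_transition_def wp g_def h_def j(1)
      by (simp add: Let_def)
    ultimately show ?thesis using that run(1) by blast
  next
    case False
    then have qr: "q < r" using admissible_bounds[OF q] by simp
    obtain j where j: "j < length e" "crossing_col e q r = Suc j" "bump_state \<nu> r 1 j e f" "f ! j \<noteq> 0"
      using upward_start_bumped[OF q qr ef] by blast
    obtain a b x t where run: "(a, b) \<in> bounded_pairs \<pi>"
      "bounded_bump 1 (Suc j) e f = Some (a, b, x, t, Bumped)"
      "bounded_bump (- 1) (crossing_col a r s) a b = bump_check (- 1) (Suc j) e f"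
      using upward_run[where J = "\<lambda>_ _ _ _. True", OF _ _ j(3)] by metis
    have "reduced e" using ef by (simp add: bounded_pairs_def reduced_words_def)
    then have "bounded_transition \<pi> a b = Some ((e, f), k)"
      using j(4) k False by (simp add: bounded_transition_def run(3) bump_check_stop_bumped)
    moreover have "inv_bounded_transition \<pi> e f k = Some (a, b)"
      using run(2) ti False j(2) unfolding inv_bounded_transition_def wp by (simp add: Let_def)
    ultimately show ?thesis using that run(1) by blast
  qed
qed

end

section \<open>The transition map on pipe dreams is a bijection\<close>

interpretation reading_order: linorder "\<lambda>x y. x = y \<or> read_before x y" read_before
  by unfold_locales (auto simp: read_before_def prod_eq_iff)

lemma reading_list_properties:
  assumes "finite D"
  shows "set (reading_list D) = D" "sorted_wrt read_before (reading_list D)"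
proof -
  have "\<exists>!xs. set xs = D \<and> sorted_wrt read_before xs"
    using reading_order.set_sorted_list_of_set[OF assms] reading_order.strict_sorted_list_of_set
      reading_order.strict_sorted_equal by metis
  then have "set (reading_list D) = D \<and> sorted_wrt read_before (reading_list D)"
    unfolding reading_list_def by (rule theI')
  then show "set (reading_list D) = D" "sorted_wrt read_before (reading_list D)" by auto
qed

lemma reading_list_eqI:
  assumes "sorted_wrt read_before xs"
  shows "reading_list (set xs) = xs"
  using reading_list_properties[of "set xs"] reading_order.strict_sorted_equal assms by auto

definition cells :: "int list \<Rightarrow> int list \<Rightarrow> (int \<times> int) list" where
  "cells a b = map2 (\<lambda>x y. (x - y + 1, y)) a b"

lemma length_cells [simp]: "length b = length a \<Longrightarrow> length (cells a b) = length a"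
  by (simp add: cells_def)

lemma nth_cells: "length b = length a \<Longrightarrow> k < length a \<Longrightarrow> cells a b ! k = (a ! k - b ! k + 1, b ! k)"
  by (simp add: cells_def)

lemma cells_words: "cells (r_word D) (j_word D) = reading_list D"
  unfolding cells_def r_word_def j_word_def by (rule nth_equalityI) (auto split: prod.splits)

lemma words_of_cells:
  assumes "length b = length a"
  shows "map (\<lambda>(i, j). i + j - 1) (cells a b) = a" "map snd (cells a b) = b"
  using assms by (auto intro!: nth_equalityI simp: nth_cells)

definition pipe_word :: "int list \<Rightarrow> int list \<Rightarrow> bool" where
  "pipe_word a b \<longleftrightarrow> sorted_wrt read_before (cells a b)"

lemma encoded_words:
  assumes "pipe_dream D"
  shows "encoded (r_word D) (j_word D) = D"
  unfolding encoded_def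
proof (rule the_equality)
  show "pipe_dream D \<and> r_word D = r_word D \<and> j_word D = j_word D" using assms by simp
  show "D' = D" if "pipe_dream D' \<and> r_word D' = r_word D \<and> j_word D' = j_word D" for D'
  proof -
    have "reading_list D' = reading_list D" using that cells_words by metis
    then show ?thesis
      using that assms reading_list_properties(1) unfolding pipe_dream_def by metis
  qed
qed

lemma reduced_pipe_dream_words:
  assumes "D \<in> reduced_pipe_dreams \<tau>"
  shows "(r_word D, j_word D) \<in> bounded_pairs \<tau>" "pipe_word (r_word D) (j_word D)"
    "encoded (r_word D) (j_word D) = D"
proof -
  have D: "finite D" "D \<subseteq> {1..} \<times> {1..}" "pipe_dream D"
    using assms by (auto simp: reduced_pipe_dreams_def pipe_dream_def)
  show "encoded (r_word D) (j_word D) = D" using encoded_words[OF D(3)] .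
  show "pipe_word (r_word D) (j_word D)"
    using reading_list_properties(2)[OF D(1)] by (simp add: pipe_word_def cells_words)
  have "bounded_word (r_word D) (j_word D)"
  proof (rule bounded_wordI)
    show "length (j_word D) = length (r_word D)" by (simp add: r_word_def j_word_def)
    show "1 \<le> j_word D ! k \<and> j_word D ! k \<le> r_word D ! k" if "k < length (r_word D)" for k
    proof -
      have k: "k < length (reading_list D)" using that by (simp add: r_word_def)
      then have "reading_list D ! k \<in> {1..} \<times> {1..}"
        using D(1,2) reading_list_properties(1) nth_mem by blast
      then show ?thesis using k by (auto simp: r_word_def j_word_def split: prod.splits)
    qed
  qed
  then show "(r_word D, j_word D) \<in> bounded_pairs \<tau>"
    using assms by (simp add: bounded_pairs_def reduced_words_def reduced_pipe_dreams_def pipe_perm_def)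
qed

lemma encoded_reduced_pipe_dream:
  assumes ab: "(a, b) \<in> bounded_pairs \<tau>" and pw: "pipe_word a b"
  shows "encoded a b \<in> reduced_pipe_dreams \<tau>" "r_word (encoded a b) = a" "j_word (encoded a b) = b"
proof -
  let ?D = "set (cells a b)"
  have len: "length b = length a" and bnd: "\<And>k. k < length a \<Longrightarrow> 1 \<le> b ! k \<and> b ! k \<le> a ! k"
    using ab by (auto simp: bounded_pairs_def bounded_word_def)
  have rl: "reading_list ?D = cells a b"
    using pw by (simp add: pipe_word_def reading_list_eqI)
  have "?D \<subseteq> {1..} \<times> {1..}"
    using len bnd by (auto simp: in_set_conv_nth nth_cells)
  then have pd: "pipe_dream ?D" by (simp add: pipe_dream_def)
  have words: "r_word ?D = a" "j_word ?D = b"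
    using words_of_cells[OF len] by (simp_all add: r_word_def j_word_def rl)
  then have eq: "encoded a b = ?D" using encoded_words[OF pd] by simp
  show "r_word (encoded a b) = a" "j_word (encoded a b) = b" using words eq by simp_all
  show "encoded a b \<in> reduced_pipe_dreams \<tau>"
    using pd words eq ab
    by (simp add: reduced_pipe_dreams_def pipe_perm_def bounded_pairs_def reduced_words_def)
qed

lemma pipe_word_iff_consecutive:
  assumes "length b = length a"
  shows "pipe_word a b \<longleftrightarrow> (\<forall>k. Suc k < length a \<longrightarrow>
    a ! k - b ! k < a ! Suc k - b ! Suc k \<or>
    a ! k - b ! k = a ! Suc k - b ! Suc k \<and> a ! Suc k < a ! k)"
proof -
  have "transp read_before" by (auto simp: transp_def read_before_def)
  then show ?thesis
    using assms unfolding pipe_word_def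
    by (auto simp: sorted_wrt_iff_nth_Suc_transp nth_cells read_before_def)
qed

text \<open>Bumping changes \<open>a\<^sub>k\<close> and \<open>b\<^sub>k\<close> together, so it preserves the row \<open>a\<^sub>k - b\<^sub>k + 1\<close> of every
  crossing. Within a row the letters have to decrease strictly. The pushed letter may become equal
  to its neighbour in the direction of the push; deleting either of the two then gives the same word,
  so the neighbour is the defect and is pushed next. Hence the only possible violation sits
  next to the current column, on the side given by the direction.\<close>

definition rows_decrease :: "int \<Rightarrow> nat \<Rightarrow> int list \<Rightarrow> int list \<Rightarrow> bool" where
  "rows_decrease \<epsilon> i a b \<longleftrightarrow> (\<forall>k. Suc k < length a \<longrightarrow>
    a ! k - b ! k < a ! Suc k - b ! Suc k \<or>
    a ! k - b ! k = a ! Suc k - b ! Suc k \<and>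
      (a ! Suc k < a ! k \<or> a ! Suc k = a ! k \<and> i = (if \<epsilon> = 1 then k else Suc k)))"

lemma pipe_word_rows_decrease: "pipe_word a b \<Longrightarrow> length b = length a \<Longrightarrow> rows_decrease \<epsilon> i a b"
  by (auto simp: pipe_word_iff_consecutive rows_decrease_def)

lemma rows_decrease_push:
  assumes rd: "rows_decrease \<epsilon> i a b" and st: "bump_state \<nu> r \<epsilon> i a b" and \<epsilon>: "\<epsilon> \<in> {1, - 1}"
  shows "rows_decrease (- \<epsilon>) i (push \<epsilon> (Suc i) a) (push \<epsilon> (Suc i) b)"
  unfolding rows_decrease_def
proof (intro allI impI)
  fix k assume "Suc k < length (push \<epsilon> (Suc i) a)"
  then have k: "Suc k < length a" by simp
  have len: "i < length a" "length b = length a" using st by (auto simp: bump_state_def)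
  have old: "a ! k - b ! k < a ! Suc k - b ! Suc k \<or>
    a ! k - b ! k = a ! Suc k - b ! Suc k \<and>
      (a ! Suc k < a ! k \<or> a ! Suc k = a ! k \<and> i = (if \<epsilon> = 1 then k else Suc k))"
    using rd k unfolding rows_decrease_def by blast
  consider "i = k" | "i = Suc k" | "i \<noteq> k" "i \<noteq> Suc k" by blast
  then show "push \<epsilon> (Suc i) a ! k - push \<epsilon> (Suc i) b ! k
      < push \<epsilon> (Suc i) a ! Suc k - push \<epsilon> (Suc i) b ! Suc k \<or>
    push \<epsilon> (Suc i) a ! k - push \<epsilon> (Suc i) b ! k
      = push \<epsilon> (Suc i) a ! Suc k - push \<epsilon> (Suc i) b ! Suc k \<and>
    (push \<epsilon> (Suc i) a ! Suc k < push \<epsilon> (Suc i) a ! k \<or>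
     push \<epsilon> (Suc i) a ! Suc k = push \<epsilon> (Suc i) a ! k \<and> i = (if - \<epsilon> = 1 then k else Suc k))"
  proof cases
    case 1
    then show ?thesis using old len \<epsilon> by auto
  next
    case 2
    then show ?thesis using old len \<epsilon> by auto
  next
    case 3
    then show ?thesis using old by (auto split: if_splits)
  qed
qed

lemma delete_col_equal_neighbours:
  assumes "Suc k < length a" "a ! Suc k = a ! k"
  shows "delete_col (Suc (Suc k)) a = delete_col (Suc k) a"
  using assms by (simp add: delete_col_Suc take_Suc_conv_app_nth Cons_nth_drop_Suc[symmetric])

lemma rows_decrease_defect:
  assumes rd: "rows_decrease (- \<epsilon>) i a b" and st: "bump_state \<nu> r (- \<epsilon>) i a b" and \<epsilon>: "\<epsilon> \<in> {1, - 1}"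
    and uniq: "\<forall>k. k \<noteq> i \<longrightarrow> nearly_reduced a (Suc k) \<longrightarrow> k = j"
  shows "rows_decrease \<epsilon> j a b"
  unfolding rows_decrease_def
proof (intro allI impI)
  fix k assume k: "Suc k < length a"
  have red: "reduced (delete_col (Suc i) a)" using st by (simp add: bump_state_def)
  have "j = (if \<epsilon> = 1 then k else Suc k)" if "a ! Suc k = a ! k" "i = (if - \<epsilon> = 1 then k else Suc k)"
  proof (cases "\<epsilon> = 1")
    case True
    then have "i = Suc k" using that(2) by simp
    then show ?thesis
      using uniq[rule_format, of k] red delete_col_equal_neighbours[OF k that(1)] k True
      by (simp add: nearly_reduced_Suc)
  next
    case False
    then have "i = k" using that(2) \<epsilon> by simp
    then show ?thesis
      using uniq[rule_format, of "Suc k"] red delete_col_equal_neighbours[OF k that(1)] k False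
      by (simp add: nearly_reduced_Suc)
  qed
  then show "a ! k - b ! k < a ! Suc k - b ! Suc k \<or>
    a ! k - b ! k = a ! Suc k - b ! Suc k \<and>
      (a ! Suc k < a ! k \<or> a ! Suc k = a ! k \<and> j = (if \<epsilon> = 1 then k else Suc k))"
    using rd k unfolding rows_decrease_def by blast
qed

text \<open>Equal neighbouring letters make the same two wires cross twice in succession.\<close>

lemma reduced_neighbours_distinct:
  assumes "reduced a" "Suc k < length a"
  shows "a ! Suc k \<noteq> a ! k"
proof
  assume eq: "a ! Suc k = a ! k"
  have "column_label a k x = column_label a (Suc k) (simple_transp (a ! Suc k) x)" for x
    using assms(2) by (simp add: column_label_def Cons_nth_drop_Suc[symmetric] word_perm_append)
  then have "crossings a ! k = crossings a ! Suc k"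
    using assms(2) eq by (auto simp: nth_crossings simple_transp_def)
  then show False
    using assms nth_eq_iff_index_eq[of "crossings a" k "Suc k"] by (simp add: reduced_iff_distinct)
qed

lemma rows_decrease_reduced_pipe_word:
  "rows_decrease \<epsilon> i a b \<Longrightarrow> reduced a \<Longrightarrow> length b = length a \<Longrightarrow> pipe_word a b"
  using reduced_neighbours_distinct[of a]
  unfolding pipe_word_iff_consecutive rows_decrease_def by blast

text \<open>A cell in column 0 is the last one of its row, because all other cells have positive columns;
  so the one pair of neighbours that might violate the order does not lie in a common row.\<close>

lemma rows_decrease_zero_pipe_word:
  assumes "rows_decrease 1 j a b" "bump_state \<nu> r 1 j a b" "b ! j = 0"
  shows "pipe_word a b"
proof -
  have len: "length b = length a" using assms(2) by (simp add: bump_state_def)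
  have "1 \<le> b ! Suc j" if "Suc j < length a"
    using assms(2) that unfolding bump_state_def by auto
  then show ?thesis
    using assms(1,3) unfolding pipe_word_iff_consecutive[OF len] rows_decrease_def by fastforce
qed

lemma pipe_word_delete:
  assumes "pipe_word a b" "length b = length a" "j < length a"
  shows "pipe_word (delete_col (Suc j) a) (delete_col (Suc j) b)"
proof -
  have "take j (cells a b) @ cells a b ! j # drop (Suc j) (cells a b) = cells a b"
    using assms by (intro id_take_nth_drop[symmetric]) simp
  then have "sorted_wrt read_before (take j (cells a b) @ cells a b ! j # drop (Suc j) (cells a b))"
    using assms(1) by (simp add: pipe_word_def)
  then have "sorted_wrt read_before (take j (cells a b) @ drop (Suc j) (cells a b))"
    by (simp add: sorted_wrt_append)
  moreover have "cells (delete_col (Suc j) a) (delete_col (Suc j) b) =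
      take j (cells a b) @ drop (Suc j) (cells a b)"
    using assms(2,3) by (simp add: cells_def delete_col_Suc take_map drop_map take_zip drop_zip)
  ultimately show ?thesis by (simp add: pipe_word_def)
qed

lemma pipe_word_rows_mono:
  assumes "pipe_word a b" "length b = length a" "k \<le> l" "l < length a"
  shows "a ! k - b ! k \<le> a ! l - b ! l"
proof (cases "k = l")
  case False
  then have "read_before (cells a b ! k) (cells a b ! l)"
    using assms unfolding pipe_word_def sorted_wrt_iff_nth_less by simp
  then show ?thesis using assms by (auto simp: nth_cells read_before_def)
qed simp

lemma word_perm_fixes_below: "\<forall>z\<in>set v. y < z \<Longrightarrow> word_perm v y = y"
  by (induction v) (auto simp: simple_transp_def transpose_def)

context nontrivial_permutation
begin

text \<open>The last letter of a reduced word for \<open>\<nu>\<close> is a descent of \<open>\<nu>\<close>, hence at most \<open>r\<close>; it bounds the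
  row of the last crossing, and so all rows.\<close>

lemma rows_le_r:
  assumes ef: "(e, f) \<in> bounded_pairs \<nu>" and pw: "pipe_word e f" and k: "k < length e"
  shows "e ! k - f ! k < r"
proof -
  let ?l = "length e - 1"
  have red: "reduced e" "word_perm e = \<nu>" and bw: "bounded_word e f"
    using ef by (auto simp: bounded_pairs_def reduced_words_def)
  have l: "?l < length e" "k \<le> ?l" using k by auto
  have "crossings e ! ?l = {e ! ?l, e ! ?l + 1}"
    using nth_crossings[OF l(1)] l by (simp add: column_label_def)
  then have "{e ! ?l, e ! ?l + 1} \<in> crossed \<nu>"
    using set_crossings_reduced[OF red(1)] red(2) l(1) by (metis length_crossings nth_mem)
  then have "\<nu> (e ! ?l + 1) < \<nu> (e ! ?l)" by (simp add: pair_in_crossed)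
  then have "e ! ?l \<le> r"
    using nu_increasing_above_r[of "e ! ?l" "e ! ?l + 1"] by force
  moreover have "1 \<le> f ! ?l" using bw l(1) by (simp add: bounded_word_def)
  moreover have "e ! k - f ! k \<le> e ! ?l - f ! ?l"
    using pipe_word_rows_mono[OF pw _ l(2,1)] bw by (simp add: bounded_word_def)
  ultimately show ?thesis by linarith
qed

text \<open>In a pipe dream a deletion can only happen in the last column: the crossings after the deleted
  one would lie in rows further down, so their letters would not move wire \<open>r\<close>, whose position is the
  row of the deleted crossing. That row would thus be \<open>r\<close>, but no crossing lies in a row beyond
  \<open>r\<close>. This is why the inverse transition map can always insert the letter \<open>r - 1\<close> at the end.\<close>

lemma deletion_in_last_column:
  assumes st: "bump_state \<nu> r 1 j a b" and zero: "b ! j = 0" and rd: "rows_decrease 1 j a b"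
  shows "Suc j = length a" "a ! j = r - 1"
proof -
  have pw: "pipe_word a b" using rows_decrease_zero_pipe_word[OF rd st zero] .
  have len: "j < length a" "length b = length a" and up: "upper_wire a j = r"
    and bnd: "\<And>k. k < length a \<Longrightarrow> k \<noteq> j \<Longrightarrow> 1 \<le> b ! k"
    using st by (auto simp: bump_state_def)
  show last: "Suc j = length a"
  proof (rule ccontr)
    assume "Suc j \<noteq> length a"
    then have j: "Suc j < length a" using len by simp
    have row: "a ! j < a ! Suc j - b ! Suc j"
      using rd j bnd[of "Suc j"] zero unfolding rows_decrease_def by force
    have low: "a ! j < a ! k - b ! k" if "j < k" "k < length a" for k
      using row pipe_word_rows_mono[OF pw len(2), of "Suc j" k] that by simp
    have "\<forall>z\<in>set (rev (drop (Suc j) a)). a ! j + 1 < z"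
    proof
      fix z assume "z \<in> set (rev (drop (Suc j) a))"
      then obtain n where "z = a ! (Suc j + n)" "Suc j + n < length a"
        by (auto simp: in_set_conv_nth)
      then show "a ! j + 1 < z" using low[of "Suc j + n"] bnd[of "Suc j + n"] by simp
    qed
    then have "a ! j + 1 = r"
      using up word_perm_fixes_below by (simp add: column_label_def)
    moreover have "a ! Suc j - b ! Suc j < r"
    proof -
      have "delete_col (Suc j) a ! j = a ! Suc j" "delete_col (Suc j) b ! j = b ! Suc j"
        using j len by (simp_all add: delete_col_Suc nth_append)
      then show ?thesis
        using rows_le_r[OF downward_end_deleted[OF st] pipe_word_delete[OF pw len(2,1)], of j] j
        by simp
    qed
    ultimately show False using row by simp
  qed
  then show "a ! j = r - 1" using up by (simp add: column_label_def)
qed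

lemma transition_inverse:
  assumes D: "D \<in> reduced_pipe_dreams \<pi>"
  obtains q E where "admissible \<pi> q" "E \<in> reduced_pipe_dreams (\<nu> \<circ> transpose q r)"
    "transition \<pi> D = Some E" "inv_transition \<pi> E = Some D"
proof -
  let ?a = "r_word D" and ?b = "j_word D"
  note ab = reduced_pipe_dream_words[OF D]
  have len_ab: "length ?b = length ?a" "length ?a = perm_length \<pi>"
    using bounded_pair_length[OF ab(1)] by auto
  obtain j a' b' x t where run: "bump_state \<nu> r 1 j a' b'" "rows_decrease 1 j a' b'"
    "b' ! j = 0 \<or> reduced a'" "length a' = length ?a"
    "bounded_bump (- 1) (crossing_col ?a r s) ?a ?b = bump_check (- 1) (Suc j) a' b'"
    "bounded_bump 1 (Suc j) a' b' = Some (?a, ?b, x, t, Bumped)"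
  proof (rule downward_run[where J = rows_decrease, OF _ _ ab(1)])
    show "rows_decrease 1 i (push (- 1) (Suc i) a) (push (- 1) (Suc i) b)"
      if "rows_decrease (- 1) i a b" "bump_state \<nu> r (- 1) i a b" for i a b
      using rows_decrease_push[OF that] by simp
    show "rows_decrease (- 1) j a b"
      if "rows_decrease 1 i a b" "bump_state \<nu> r 1 i a b" "b ! i \<noteq> 0"
        "\<forall>k. k \<noteq> i \<longrightarrow> nearly_reduced a (Suc k) \<longrightarrow> k = j" for i j a b
      using rows_decrease_defect[of "- 1" i a b \<nu> r j] that by simp
    show "rows_decrease (- 1) i ?a ?b" for i
      using pipe_word_rows_decrease[OF ab(2) len_ab(1)] .
  qed
  have len: "j < length a'" "length b' = length a'"
    using run(1) by (auto simp: bump_state_def)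
  show ?thesis
  proof (cases "b' ! j = 0")
    case True
    let ?e = "delete_col (Suc j) a'" and ?f = "delete_col (Suc j) b'"
    have ef: "(?e, ?f) \<in> bounded_pairs \<nu>" using downward_end_deleted[OF run(1)] .
    have "pipe_word ?e ?f"
      using pipe_word_delete[OF rows_decrease_zero_pipe_word[OF run(2,1) True] len(2,1)] .
    note E = encoded_reduced_pipe_dream[OF ef this]
    have last: "Suc j = perm_length \<pi>" "a' ! j = r - 1"
      using deletion_in_last_column[OF run(1) True run(2)] run(4) len_ab by simp_all
    have fwd: "transition \<pi> D = Some (encoded ?e ?f)"
      by (simp add: transition_def run(5) bump_check_stop_deleted[of b' j, OF True])
    have wp: "pipe_perm (encoded ?e ?f) = \<nu>"
      using E(1) by (simp add: reduced_pipe_dreams_def)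
    have ti: "transition_index \<pi> \<nu> = r"
      using transition_index_eq[OF admissible_r] by simp
    have "insert_col (Suc j) (r - 1) ?e = a'" "insert_col (Suc j) 0 ?f = b'"
      using insert_col_delete_col[of j a'] insert_col_delete_col[of j b'] len True last by simp_all
    then have "inv_transition \<pi> (encoded ?e ?f) = Some D"
      using run(6) ab(3) by (simp add: inv_transition_def wp ti Let_def E(2,3) last(1)[symmetric])
    then show ?thesis using that[OF admissible_r, of "encoded ?e ?f"] E(1) fwd by simp
  next
    case False
    then have red: "reduced a'" using run(3) by simp
    obtain q where q: "admissible \<pi> q" "q < r" "(a', b') \<in> bounded_pairs (\<nu> \<circ> transpose q r)"
      "crossing_col a' q r = Suc j"
      using downward_end_bumped[OF run(1) False red] by blast
    note E = encoded_reduced_pipe_dream[OF q(3) rows_decrease_reduced_pipe_word[OF run(2) red len(2)]]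
    have fwd: "transition \<pi> D = Some (encoded a' b')"
      by (simp add: transition_def run(5) bump_check_stop_bumped[of b' j, OF False red])
    have "pipe_perm (encoded a' b') = \<nu> \<circ> transpose q r"
      using E(1) by (simp add: reduced_pipe_dreams_def)
    then have "inv_transition \<pi> (encoded a' b') = Some D"
      using q(2,4) run(6) ab(3) transition_index_eq[OF q(1)]
      by (simp add: inv_transition_def Let_def E(2,3))
    then show ?thesis using that[OF q(1) E(1)] fwd by simp
  qed
qed

lemma upward_pipe_run:
  assumes "bump_state \<nu> r 1 j g h" "pipe_word g h"
  obtains a b x t where "(a, b) \<in> bounded_pairs \<pi>" "pipe_word a b"
    "bounded_bump 1 (Suc j) g h = Some (a, b, x, t, Bumped)"
    "bounded_bump (- 1) (crossing_col a r s) a b = bump_check (- 1) (Suc j) g h"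
proof -
  obtain i a b x t where run: "rows_decrease (- 1) i a b" "(a, b) \<in> bounded_pairs \<pi>"
    "bounded_bump 1 (Suc j) g h = Some (a, b, x, t, Bumped)"
    "bounded_bump (- 1) (crossing_col a r s) a b = bump_check (- 1) (Suc j) g h"
  proof (rule upward_run[where J = rows_decrease, OF _ _ assms(1)])
    show "rows_decrease (- 1) i (push 1 (Suc i) a) (push 1 (Suc i) b)"
      if "rows_decrease 1 i a b" "bump_state \<nu> r 1 i a b" for i a b
      using rows_decrease_push[OF that] by simp
    show "rows_decrease 1 j a b"
      if "rows_decrease (- 1) i a b" "bump_state \<nu> r (- 1) i a b" "b ! i \<noteq> 0"
        "\<forall>k. k \<noteq> i \<longrightarrow> nearly_reduced a (Suc k) \<longrightarrow> k = j" for i j a b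
      using rows_decrease_defect[of 1 i a b \<nu> r j] that by simp
    show "rows_decrease 1 j g h"
      using pipe_word_rows_decrease[OF assms(2)] assms(1) by (simp add: bump_state_def)
  qed
  moreover have "pipe_word a b"
    using rows_decrease_reduced_pipe_word[OF run(1)] run(2)
    by (simp add: bounded_pairs_def reduced_words_def bounded_word_def)
  ultimately show ?thesis using that by blast
qed

lemma inv_transition_inverse:
  assumes q: "admissible \<pi> q" and E: "E \<in> reduced_pipe_dreams (\<nu> \<circ> transpose q r)"
  obtains D where "D \<in> reduced_pipe_dreams \<pi>" "inv_transition \<pi> E = Some D"
    "transition \<pi> D = Some E"
proof -
  let ?e = "r_word E" and ?f = "j_word E"
  note ef = reduced_pipe_dream_words[OF E]
  have wp: "pipe_perm E = \<nu> \<circ> transpose q r" using E by (simp add: reduced_pipe_dreams_def)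
  have ti: "transition_index \<pi> (\<nu> \<circ> transpose q r) = q" using transition_index_eq[OF q] .
  have len: "length ?f = length ?e"
    using bounded_pair_length[OF ef(1)] by auto
  show ?thesis
  proof (cases "q = r")
    case True
    have ef_nu: "(?e, ?f) \<in> bounded_pairs \<nu>" using ef(1) True by simp
    define j where "j = length ?e"
    have p: "perm_length \<pi> = Suc j"
      using bounded_pair_length[OF ef_nu] perm_length_nu by (simp add: j_def)
    define g where "g = insert_col (Suc j) (r - 1) ?e"
    define h where "h = insert_col (Suc j) 0 ?f"
    have gh: "g = ?e @ [r - 1]" "h = ?f @ [0]"
      using len by (simp_all add: g_def h_def j_def insert_col_def)
    have "word_perm (rev (drop j ?e)) = id" by (simp add: j_def)
    then have "inv (word_perm (rev (drop (Suc j - 1) ?e))) r - 1 = r - 1" by (simp add: inv_id)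
    then have st: "bump_state \<nu> r 1 j g h"
      using upward_start_inserted[OF ef_nu, of "Suc j"] p unfolding g_def h_def by simp
    have "pipe_word g h"
    proof -
      have "read_before c (r, 0)" if c: "c \<in> set (cells ?e ?f)" for c
      proof -
        obtain k where "k < length (cells ?e ?f)" "cells ?e ?f ! k = c"
          using c unfolding in_set_conv_nth by blast
        then have k: "k < length ?e" "c = (?e ! k - ?f ! k + 1, ?f ! k)"
          using len by (simp_all add: nth_cells)
        have "1 \<le> ?f ! k" using ef(1) k(1) by (simp add: bounded_pairs_def bounded_word_def)
        then show ?thesis
          using rows_le_r[OF ef_nu ef(2) k(1)] k(2) by (auto simp: read_before_def)
      qed
      moreover have "cells g h = cells ?e ?f @ [(r, 0)]"
        using len by (simp add: gh cells_def)
      ultimately show ?thesis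
        using ef(2) by (simp add: pipe_word_def sorted_wrt_append)
    qed
    then obtain a b x t where run: "(a, b) \<in> bounded_pairs \<pi>" "pipe_word a b"
      "bounded_bump 1 (Suc j) g h = Some (a, b, x, t, Bumped)"
      "bounded_bump (- 1) (crossing_col a r s) a b = bump_check (- 1) (Suc j) g h"
      using upward_pipe_run[OF st] by metis
    note D = encoded_reduced_pipe_dream[OF run(1,2)]
    have "delete_col (Suc j) g = ?e" "delete_col (Suc j) h = ?f" "h ! j = 0"
      using len by (simp_all add: g_def h_def j_def delete_col_insert_col nth_insert_col)
    then have "transition \<pi> (encoded a b) = Some E"
      using ef(3) by (simp add: transition_def D(2,3) run(4) bump_check_stop_deleted)
    moreover have "inv_transition \<pi> E = Some (encoded a b)"
      using run(3) ti True unfolding inv_transition_def wp p g_def h_def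
      by (simp add: Let_def)
    ultimately show ?thesis using that D(1) by blast
  next
    case False
    then have qr: "q < r" using admissible_bounds[OF q] by simp
    obtain j where j: "j < length ?e" "crossing_col ?e q r = Suc j" "bump_state \<nu> r 1 j ?e ?f"
      "?f ! j \<noteq> 0"
      using upward_start_bumped[OF q qr ef(1)] by blast
    obtain a b x t where run: "(a, b) \<in> bounded_pairs \<pi>" "pipe_word a b"
      "bounded_bump 1 (Suc j) ?e ?f = Some (a, b, x, t, Bumped)"
      "bounded_bump (- 1) (crossing_col a r s) a b = bump_check (- 1) (Suc j) ?e ?f"
      using upward_pipe_run[OF j(3) ef(2)] by metis
    note D = encoded_reduced_pipe_dream[OF run(1,2)]
    have "reduced ?e" using ef(1) by (simp add: bounded_pairs_def reduced_words_def)
    then have "transition \<pi> (encoded a b) = Some E"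
      using j(4) ef(3) by (simp add: transition_def D(2,3) run(4) bump_check_stop_bumped)
    moreover have "inv_transition \<pi> E = Some (encoded a b)"
      using run(3) ti False j(2) unfolding inv_transition_def wp by (simp add: Let_def)
    ultimately show ?thesis using that D(1) by blast
  qed
qed

end

section \<open>The Macdonald map and its inverse\<close>

lemma bounded_pairs_id: "bounded_pairs id = {([], [])}"
proof -
  have "([], []) \<in> bounded_pairs id"
    by (simp add: bounded_pairs_def reduced_words_def reduced_def bounded_word_def perm_length_id)
  moreover have "a = [] \<and> b = []" if "(a, b) \<in> bounded_pairs id" for a b
    using bounded_pair_length[OF that] perm_length_id by simp
  ultimately show ?thesis by auto
qed

lemma reduced_pipe_dreams_id: "reduced_pipe_dreams id = {{}}"
proof -
  have "reading_list {} = []" using reading_list_eqI[of "[]"] by simp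
  then have "{} \<in> reduced_pipe_dreams id"
    using bounded_pairs_id
    by (auto simp: reduced_pipe_dreams_def pipe_dream_def pipe_perm_def r_word_def bounded_pairs_def
        reduced_words_def)
  moreover have "D = {}" if D: "D \<in> reduced_pipe_dreams id" for D
  proof -
    have "r_word D = []" using reduced_pipe_dream_words(1)[OF D] bounded_pairs_id by auto
    then show ?thesis
      using D reading_list_properties(1)[of D]
      by (auto simp: reduced_pipe_dreams_def pipe_dream_def r_word_def)
  qed
  ultimately show ?thesis by auto
qed

lemma macdonald_id: "macdonald ([], []) = Some ([], {})"
  by (subst macdonald.simps) simp

lemma inverse_macdonald_id: "inverse_macdonald ([], {}) = Some ([], [])"
proof -
  have "pipe_perm {} = id"
    using reduced_pipe_dreams_id by (auto simp: reduced_pipe_dreams_def)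
  then show ?thesis by (subst inverse_macdonald.simps) simp
qed

context nontrivial_permutation
begin

lemma macdonald_step:
  assumes ab: "(a, b) \<in> bounded_pairs \<pi>" and q: "admissible \<pi> q"
    and e: "(e, f) \<in> bounded_pairs (\<nu> \<circ> transpose q r)"
    and "bounded_transition \<pi> a b = Some ((e, f), k)"
    and "macdonald (e, f) = Some (c, E)"
    and "inv_transition \<pi> E = Some D"
  shows "macdonald (a, b) = Some (if q = r then insert_col (perm_length \<pi>) k c else c, D)"
proof -
  have "word_perm a = \<pi>" "word_perm e = \<nu> \<circ> transpose q r"
    using ab e by (auto simp: bounded_pairs_def reduced_words_def)
  then show ?thesis
    using assms nontrivial admissible_bounds[OF q]
    by (subst macdonald.simps) (auto simp: transition_index_eq Let_def)
qed

lemma inverse_macdonald_step: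
  assumes D: "D \<in> reduced_pipe_dreams \<pi>" and q: "admissible \<pi> q"
    and E: "E \<in> reduced_pipe_dreams (\<nu> \<circ> transpose q r)"
    and "transition \<pi> D = Some E"
    and k: "q \<noteq> r \<Longrightarrow> k = 0" and len: "length c = perm_length (\<nu> \<circ> transpose q r)"
    and "inverse_macdonald (c, E) = Some (e, f)"
    and "inv_bounded_transition \<pi> e f k = Some (a, b)"
  shows "inverse_macdonald (if q = r then insert_col (perm_length \<pi>) k c else c, D) = Some (a, b)"
proof -
  have *: "pipe_perm D = \<pi>" "pipe_perm E = \<nu> \<circ> transpose q r"
    using D E by (auto simp: reduced_pipe_dreams_def)
  have "insert_col (perm_length \<pi>) k c ! (perm_length \<pi> - 1) = k \<and>
      take (perm_length \<pi> - 1) (insert_col (perm_length \<pi>) k c) = c" if "q = r"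
    using len that perm_length_nu by (simp add: insert_col_def nth_append)
  then show ?thesis
    using assms * nontrivial admissible_bounds[OF q]
    by (subst inverse_macdonald.simps) (auto simp: transition_index_eq Let_def)
qed

lemma c_vectors_step:
  assumes q: "admissible \<pi> q" and k: "if q = r then 1 \<le> k \<and> k \<le> perm_length \<pi> else k = 0"
    and c: "c \<in> c_vectors (\<nu> \<circ> transpose q r)"
  shows "(if q = r then insert_col (perm_length \<pi>) k c else c) \<in> c_vectors \<pi>"
proof (cases "q = r")
  case True
  then have "length c = perm_length \<nu>" "insert_col (perm_length \<pi>) k c = c @ [k]"
    using c perm_length_nu by (auto simp: c_vectors_def insert_col_def)
  then show ?thesis
    using True c k perm_length_nu by (auto simp: c_vectors_def nth_append less_Suc_eq)
next
  case False
  then show ?thesis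
    using c admissible_less(1)[OF q] admissible_bounds[OF q] by (simp add: c_vectors_def)
qed

lemma c_vectors_split:
  assumes q: "admissible \<pi> q" and c: "c \<in> c_vectors \<pi>"
  obtains k c' where "if q = r then 1 \<le> k \<and> k \<le> perm_length \<pi> else k = 0"
    "c' \<in> c_vectors (\<nu> \<circ> transpose q r)"
    "c = (if q = r then insert_col (perm_length \<pi>) k c' else c')"
proof (cases "q = r")
  case True
  have len: "length c = Suc (perm_length \<nu>)"
    and bnd: "\<And>i. i < length c \<Longrightarrow> 1 \<le> c ! i \<and> c ! i \<le> i + 1"
    using c perm_length_nu by (auto simp: c_vectors_def)
  let ?k = "c ! perm_length \<nu>" and ?c = "take (perm_length \<nu>) c"
  have "?c \<in> c_vectors \<nu>" using len bnd by (auto simp: c_vectors_def)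
  moreover have "c = insert_col (perm_length \<pi>) ?k ?c"
    using len perm_length_nu take_Suc_conv_app_nth[of "perm_length \<nu>" c]
    by (simp add: insert_col_def)
  moreover have "1 \<le> ?k \<and> ?k \<le> perm_length \<pi>" using bnd len perm_length_nu by simp
  ultimately show ?thesis using that[of ?k ?c] True by simp
next
  case False
  then show ?thesis
    using that[of 0 c] c admissible_less(1)[OF q] admissible_bounds[OF q] by (simp add: c_vectors_def)
qed

end

text \<open>Both algorithms combine a transition of bounded pairs with one of pipe dreams, and each of these
  has a two-sided inverse. A bounded pair is moved down by its transition, across by the induction
  hypothesis, and up by the inverse transition of pipe dreams; the inverse algorithm takes the same
  three steps backwards. The entry of \<open>c\<close> added in a step remembers the column of the deletion, which
  is forgotten on the side of pipe dreams because there it is always the last column.\<close>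

theorem corollary5p4:
  fixes \<pi> :: "int \<Rightarrow> int"
  assumes "\<pi> \<in> S_infinity"
  shows "(\<forall>ab \<in> bounded_pairs \<pi>. \<exists>cD \<in> cD_pairs \<pi>.
            macdonald ab = Some cD \<and> inverse_macdonald cD = Some ab) \<and>
         (\<forall>cD \<in> cD_pairs \<pi>. \<exists>ab \<in> bounded_pairs \<pi>.
            inverse_macdonald cD = Some ab \<and> macdonald ab = Some cD)"
  using wf_transition_order assms
proof (induction \<pi> rule: wf_induct_rule)
  case (less \<pi>)
  show ?case
  proof (cases "\<pi> = id")
    case True
    have cD: "cD_pairs id = {([], {})}"
      by (auto simp: cD_pairs_def reduced_pipe_dreams_id c_vectors_def perm_length_id)
    show ?thesis
      unfolding True bounded_pairs_id cD by (simp add: macdonald_id inverse_macdonald_id)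
  next
    case False
    interpret nontrivial_permutation \<pi>
      using less.prems False by unfold_locales
    show ?thesis
    proof (intro conjI ballI)
      fix ab assume "ab \<in> bounded_pairs \<pi>"
      then obtain a b where ab: "ab = (a, b)" "(a, b) \<in> bounded_pairs \<pi>" by (cases ab) auto
      obtain q e f k where bt: "admissible \<pi> q" "(e, f) \<in> bounded_pairs (\<nu> \<circ> transpose q r)"
        "if q = r then 1 \<le> k \<and> k \<le> perm_length \<pi> else k = 0"
        "bounded_transition \<pi> a b = Some ((e, f), k)"
        "inv_bounded_transition \<pi> e f k = Some (a, b)"
        using bounded_transition_inverse[OF ab(2)] by blast
      obtain c E where IH: "c \<in> c_vectors (\<nu> \<circ> transpose q r)"
        "E \<in> reduced_pipe_dreams (\<nu> \<circ> transpose q r)"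
        "macdonald (e, f) = Some (c, E)" "inverse_macdonald (c, E) = Some (e, f)"
        using less.IH[OF successor_less[OF bt(1)] successor_in_S_infinity[OF bt(1)]] bt(2)
        unfolding cD_pairs_def by blast
      obtain D where D: "D \<in> reduced_pipe_dreams \<pi>" "inv_transition \<pi> E = Some D"
        "transition \<pi> D = Some E"
        using inv_transition_inverse[OF bt(1) IH(2)] by blast
      let ?c = "if q = r then insert_col (perm_length \<pi>) k c else c"
      have "(?c, D) \<in> cD_pairs \<pi>"
        using c_vectors_step[OF bt(1,3) IH(1)] D(1) by (simp add: cD_pairs_def)
      moreover have "macdonald ab = Some (?c, D)"
        unfolding ab(1) using macdonald_step[OF ab(2) bt(1,2,4) IH(3) D(2)] .
      moreover have "inverse_macdonald (?c, D) = Some ab"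
        unfolding ab(1) using inverse_macdonald_step[OF D(1) bt(1) IH(2) D(3) _ _ IH(4) bt(5)] bt(3) IH(1)
        by (simp add: c_vectors_def)
      ultimately show "\<exists>cD \<in> cD_pairs \<pi>. macdonald ab = Some cD \<and> inverse_macdonald cD = Some ab"
        by blast
    next
      fix cD assume "cD \<in> cD_pairs \<pi>"
      then obtain c D where cD: "cD = (c, D)" "c \<in> c_vectors \<pi>" "D \<in> reduced_pipe_dreams \<pi>"
        by (auto simp: cD_pairs_def)
      obtain q E where tr: "admissible \<pi> q" "E \<in> reduced_pipe_dreams (\<nu> \<circ> transpose q r)"
        "transition \<pi> D = Some E" "inv_transition \<pi> E = Some D"
        using transition_inverse[OF cD(3)] by blast
      obtain k c' where k: "if q = r then 1 \<le> k \<and> k \<le> perm_length \<pi> else k = 0"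
        "c' \<in> c_vectors (\<nu> \<circ> transpose q r)"
        "c = (if q = r then insert_col (perm_length \<pi>) k c' else c')"
        using c_vectors_split[OF tr(1) cD(2)] by blast
      have "(c', E) \<in> cD_pairs (\<nu> \<circ> transpose q r)" using k(2) tr(2) by (simp add: cD_pairs_def)
      then obtain e f where IH: "(e, f) \<in> bounded_pairs (\<nu> \<circ> transpose q r)"
        "inverse_macdonald (c', E) = Some (e, f)" "macdonald (e, f) = Some (c', E)"
        using less.IH[OF successor_less[OF tr(1)] successor_in_S_infinity[OF tr(1)]] by fast
      obtain a b where ab: "(a, b) \<in> bounded_pairs \<pi>" "inv_bounded_transition \<pi> e f k = Some (a, b)"
        "bounded_transition \<pi> a b = Some ((e, f), k)"
        using inv_bounded_transition_inverse[OF tr(1) IH(1) k(1)] by blast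
      have "inverse_macdonald cD = Some (a, b)"
        unfolding cD(1) k(3) using inverse_macdonald_step[OF cD(3) tr(1-3) _ _ IH(2) ab(2)] k(1,2)
        by (simp add: c_vectors_def)
      moreover have "macdonald (a, b) = Some cD"
        unfolding cD(1) k(3) using macdonald_step[OF ab(1) tr(1) IH(1) ab(3) IH(3) tr(4)] .
      ultimately show "\<exists>ab \<in> bounded_pairs \<pi>. inverse_macdonald cD = Some ab \<and> macdonald ab = Some cD"
        using ab(1) by blast
    qed
  qed
qed

end
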